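(* Let $\mathcal{C}$ be a triangulated category and let $q>0$ be a real number. Let $\tau$ and $\tau'$ be two (locally finite) stability conditions on $\mathcal{C}$ such that for each object $x$ of $\mathcal{C}$ we have $m_{q,\tau}(x)=m_{q,\tau'}(x)$. Then an object of $\mathcal{C}$ is $\tau$-stable if and only if it is $\tau'$-stable.
   Context: Stability conditions are Bridgeland stability conditions $\tau=(\mathcal{P},Z)$ on $\mathcal{C}$: a slicing $\mathcal{P}$ (additive subcategories $\mathcal{P}(\phi)$, $\phi\in\mathbf{R}$) and a central charge $Z\colon K(\mathcal{C})\to\mathbf{C}$, with $Z([a])\in \mathbf{R}_{>0}e^{i\pi\phi}$ for $0\neq a\in\mathcal{P}(\phi)$, and with Harder--Narasimhan (HN) filtrations. They are assumed locally finite, so that each abelian category $\mathcal{P}(\phi)$ of semistable objects of phase $\phi$ has finite length. An object is $\tau$-stable (of phase $\phi$) if it is a simple object of $\mathcal{P}(\phi)$ for some $\phi$. For an object $x$ with HN factors $a_1,\dots,a_n$, where $a_i$ is semistable of phase $\phi_i$, the $(q,\tau)$-mass is $m_{q,\tau}(x)=\sum_i q^{\phi_i}|Z(a_i)|$; the mass of the zero object is $0$. *)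

theory Defs
  imports Complex_Main "HOL-Algebra.Free_Abelian_Groups"
begin

section \<open>Additive categories\<close>

record ('o, 'm) cat =
  Ob :: "'o set"
  Arr :: "'m set"
  Dom :: "'m \<Rightarrow> 'o"
  Cod :: "'m \<Rightarrow> 'o"
  Id :: "'o \<Rightarrow> 'm"
  Comp :: "'m \<Rightarrow> 'm \<Rightarrow> 'm" (infixr \<open>\<cdot>\<index>\<close> 75)

definition Hom :: "('o, 'm, 'e) cat_scheme \<Rightarrow> 'o \<Rightarrow> 'o \<Rightarrow> 'm set" where
  "Hom C x y = {f \<in> Arr C. Dom C f = x \<and> Cod C f = y}"

locale category =
  fixes C :: "('o, 'm, 'e) cat_scheme" (structure)
  assumes Dom_closed: "f \<in> Arr C \<Longrightarrow> Dom C f \<in> Ob C"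
    and Cod_closed: "f \<in> Arr C \<Longrightarrow> Cod C f \<in> Ob C"
    and Id_closed: "x \<in> Ob C \<Longrightarrow> Id C x \<in> Hom C x x"
    and Comp_closed: "\<lbrakk>f \<in> Hom C x y; g \<in> Hom C y z\<rbrakk> \<Longrightarrow> g \<cdot> f \<in> Hom C x z"
    and Comp_Id: "f \<in> Hom C x y \<Longrightarrow> f \<cdot> Id C x = f"
    and Id_Comp: "f \<in> Hom C x y \<Longrightarrow> Id C y \<cdot> f = f"
    and Comp_assoc: "\<lbrakk>f \<in> Hom C w x; g \<in> Hom C x y; h \<in> Hom C y z\<rbrakk>
      \<Longrightarrow> (h \<cdot> g) \<cdot> f = h \<cdot> (g \<cdot> f)"

definition isomorphism :: "('o, 'm, 'e) cat_scheme \<Rightarrow> 'm \<Rightarrow> bool" where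
  "isomorphism C f \<longleftrightarrow> f \<in> Arr C \<and>
     (\<exists>g \<in> Hom C (Cod C f) (Dom C f).
        g \<cdot>\<^bsub>C\<^esub> f = Id C (Dom C f) \<and> f \<cdot>\<^bsub>C\<^esub> g = Id C (Cod C f))"

definition isomorphic :: "('o, 'm, 'e) cat_scheme \<Rightarrow> 'o \<Rightarrow> 'o \<Rightarrow> bool" where
  "isomorphic C x y \<longleftrightarrow> (\<exists>f \<in> Hom C x y. isomorphism C f)"

definition monic :: "('o, 'm, 'e) cat_scheme \<Rightarrow> 'm \<Rightarrow> bool" where
  "monic C f \<longleftrightarrow> f \<in> Arr C \<and>
     (\<forall>w \<in> Ob C. \<forall>g \<in> Hom C w (Dom C f). \<forall>h \<in> Hom C w (Dom C f).
        f \<cdot>\<^bsub>C\<^esub> g = f \<cdot>\<^bsub>C\<^esub> h \<longrightarrow> g = h)"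

definition zero_object :: "('o, 'm, 'e) cat_scheme \<Rightarrow> 'o \<Rightarrow> bool" where
  "zero_object C z \<longleftrightarrow> z \<in> Ob C \<and>
     (\<forall>x \<in> Ob C. (\<exists>!f. f \<in> Hom C z x) \<and> (\<exists>!f. f \<in> Hom C x z))"

definition simple_object :: "('o, 'm, 'e) cat_scheme \<Rightarrow> 'o \<Rightarrow> bool" where
  "simple_object C x \<longleftrightarrow> x \<in> Ob C \<and> \<not> zero_object C x \<and>
     (\<forall>f. monic C f \<and> Cod C f = x \<longrightarrow> zero_object C (Dom C f) \<or> isomorphism C f)"

definition full_subcat :: "('o, 'm, 'e) cat_scheme \<Rightarrow> 'o set \<Rightarrow> ('o, 'm, 'e) cat_scheme" where
  "full_subcat C S = C\<lparr>Ob := S, Arr := {f \<in> Arr C. Dom C f \<in> S \<and> Cod C f \<in> S}\<rparr>"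

record ('o, 'm) preaddcat = "('o, 'm) cat" +
  Zero :: "'o \<Rightarrow> 'o \<Rightarrow> 'm"
  Add :: "'m \<Rightarrow> 'm \<Rightarrow> 'm"

definition hom_group :: "('o, 'm, 'e) preaddcat_scheme \<Rightarrow> 'o \<Rightarrow> 'o \<Rightarrow> 'm monoid" where
  "hom_group C x y = \<lparr>carrier = Hom C x y, monoid.mult = Add C, one = Zero C x y\<rparr>"

definition Neg :: "('o, 'm, 'e) preaddcat_scheme \<Rightarrow> 'm \<Rightarrow> 'm" where
  "Neg C f = inv\<^bsub>hom_group C (Dom C f) (Cod C f)\<^esub> f"

definition biproduct ::
  "('o, 'm, 'e) preaddcat_scheme \<Rightarrow> 'o \<Rightarrow> 'o \<Rightarrow> 'o \<Rightarrow> 'm \<Rightarrow> 'm \<Rightarrow> 'm \<Rightarrow> 'm \<Rightarrow> bool" where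
  "biproduct C x y s i j p r \<longleftrightarrow> s \<in> Ob C \<and>
     i \<in> Hom C x s \<and> j \<in> Hom C y s \<and> p \<in> Hom C s x \<and> r \<in> Hom C s y \<and>
     p \<cdot>\<^bsub>C\<^esub> i = Id C x \<and> r \<cdot>\<^bsub>C\<^esub> j = Id C y \<and>
     p \<cdot>\<^bsub>C\<^esub> j = Zero C y x \<and> r \<cdot>\<^bsub>C\<^esub> i = Zero C x y \<and>
     Add C (i \<cdot>\<^bsub>C\<^esub> p) (j \<cdot>\<^bsub>C\<^esub> r) = Id C s"

locale additive_category = category C
  for C :: "('o, 'm, 'e) preaddcat_scheme" (structure) +
  assumes hom_group: "\<lbrakk>x \<in> Ob C; y \<in> Ob C\<rbrakk> \<Longrightarrow> comm_group (hom_group C x y)"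
    and Comp_Add_left: "\<lbrakk>f \<in> Hom C x y; g \<in> Hom C y z; g' \<in> Hom C y z\<rbrakk>
      \<Longrightarrow> Add C g g' \<cdot> f = Add C (g \<cdot> f) (g' \<cdot> f)"
    and Comp_Add_right: "\<lbrakk>f \<in> Hom C x y; f' \<in> Hom C x y; g \<in> Hom C y z\<rbrakk>
      \<Longrightarrow> g \<cdot> Add C f f' = Add C (g \<cdot> f) (g \<cdot> f')"
    and ex_zero_object: "\<exists>z. zero_object C z"
    and ex_biproduct: "\<lbrakk>x \<in> Ob C; y \<in> Ob C\<rbrakk> \<Longrightarrow> \<exists>s i j p r. biproduct C x y s i j p r"

definition is_kernel :: "('o, 'm, 'e) preaddcat_scheme \<Rightarrow> 'm \<Rightarrow> 'm \<Rightarrow> bool" where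
  "is_kernel C k f \<longleftrightarrow> k \<in> Arr C \<and> f \<in> Arr C \<and> Cod C k = Dom C f \<and>
     f \<cdot>\<^bsub>C\<^esub> k = Zero C (Dom C k) (Cod C f) \<and>
     (\<forall>g \<in> Arr C. Cod C g = Dom C f \<and> f \<cdot>\<^bsub>C\<^esub> g = Zero C (Dom C g) (Cod C f) \<longrightarrow>
        (\<exists>!h. h \<in> Hom C (Dom C g) (Dom C k) \<and> k \<cdot>\<^bsub>C\<^esub> h = g))"

definition is_cokernel :: "('o, 'm, 'e) preaddcat_scheme \<Rightarrow> 'm \<Rightarrow> 'm \<Rightarrow> bool" where
  "is_cokernel C c f \<longleftrightarrow> c \<in> Arr C \<and> f \<in> Arr C \<and> Dom C c = Cod C f \<and>
     c \<cdot>\<^bsub>C\<^esub> f = Zero C (Dom C f) (Cod C c) \<and>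
     (\<forall>g \<in> Arr C. Dom C g = Cod C f \<and> g \<cdot>\<^bsub>C\<^esub> f = Zero C (Dom C f) (Cod C g) \<longrightarrow>
        (\<exists>!h. h \<in> Hom C (Cod C c) (Cod C g) \<and> h \<cdot>\<^bsub>C\<^esub> c = g))"

text \<open>A morphism is strict if the canonical map \<open>u\<close> from its coimage (the cokernel \<open>c\<close> of its
  kernel) to its image (the kernel \<open>i\<close> of its cokernel) is an isomorphism.\<close>

definition strict_morphism :: "('o, 'm, 'e) preaddcat_scheme \<Rightarrow> 'm \<Rightarrow> bool" where
  "strict_morphism C f \<longleftrightarrow> (\<exists>k c d i u.
     is_kernel C k f \<and> is_cokernel C c k \<and> is_cokernel C d f \<and> is_kernel C i d \<and>
     u \<in> Hom C (Cod C c) (Dom C i) \<and> isomorphism C u \<and> f = i \<cdot>\<^bsub>C\<^esub> (u \<cdot>\<^bsub>C\<^esub> c))"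

definition strict_mono_into :: "('o, 'm, 'e) preaddcat_scheme \<Rightarrow> 'o \<Rightarrow> 'm \<Rightarrow> bool" where
  "strict_mono_into C x e \<longleftrightarrow> monic C e \<and> strict_morphism C e \<and> Cod C e = x"

text \<open>Chains of strict subobjects of \<open>x\<close> are given by strict monomorphisms \<open>e j\<close> into \<open>x\<close> and
  inclusions \<open>f j\<close> between their domains.  In an abelian category all morphisms are strict.\<close>

definition noetherian_object :: "('o, 'm, 'e) preaddcat_scheme \<Rightarrow> 'o \<Rightarrow> bool" where
  "noetherian_object C x \<longleftrightarrow> (\<forall>(e :: nat \<Rightarrow> 'm) f.
     (\<forall>j. strict_mono_into C x (e j) \<and>
          f j \<in> Hom C (Dom C (e j)) (Dom C (e (Suc j))) \<and> e (Suc j) \<cdot>\<^bsub>C\<^esub> f j = e j) \<longrightarrow>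
     (\<exists>N. \<forall>j \<ge> N. isomorphism C (f j)))"

definition artinian_object :: "('o, 'm, 'e) preaddcat_scheme \<Rightarrow> 'o \<Rightarrow> bool" where
  "artinian_object C x \<longleftrightarrow> (\<forall>(e :: nat \<Rightarrow> 'm) f.
     (\<forall>j. strict_mono_into C x (e j) \<and>
          f j \<in> Hom C (Dom C (e (Suc j))) (Dom C (e j)) \<and> e j \<cdot>\<^bsub>C\<^esub> f j = e (Suc j)) \<longrightarrow>
     (\<exists>N. \<forall>j \<ge> N. isomorphism C (f j)))"

definition finite_length :: "('o, 'm, 'e) preaddcat_scheme \<Rightarrow> bool" where
  "finite_length C \<longleftrightarrow> (\<forall>x \<in> Ob C. noetherian_object C x \<and> artinian_object C x)"


section \<open>Triangulated categories\<close>

text \<open>\<open>ShO\<close> and \<open>ShA\<close> are the shift functor on objects and on morphisms; \<open>(f, g, h) \<in> Tri C\<close>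
  says that \<open>x \<rightarrow> y \<rightarrow> z \<rightarrow> x[1]\<close> with maps \<open>f\<close>, \<open>g\<close>, \<open>h\<close> is a distinguished triangle.\<close>

record ('o, 'm) tricat = "('o, 'm) preaddcat" +
  ShO :: "'o \<Rightarrow> 'o"
  ShA :: "'m \<Rightarrow> 'm"
  Tri :: "('m \<times> 'm \<times> 'm) set"

definition triangle :: "('o, 'm, 'e) tricat_scheme \<Rightarrow> 'm \<Rightarrow> 'm \<Rightarrow> 'm \<Rightarrow> bool" where
  "triangle C f g h \<longleftrightarrow> f \<in> Arr C \<and> g \<in> Arr C \<and> h \<in> Arr C \<and>
     Cod C f = Dom C g \<and> Cod C g = Dom C h \<and> Cod C h = ShO C (Dom C f)"

text \<open>The shift is only required to be an autoequivalence (fully faithful and essentially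
  surjective), which includes the case of an automorphism.  The last axiom is the octahedral
  axiom.\<close>

locale triangulated_category = additive_category C
  for C :: "('o, 'm, 'e) tricat_scheme" (structure) +
  assumes ShO_closed: "x \<in> Ob C \<Longrightarrow> ShO C x \<in> Ob C"
    and ShA_bij: "\<lbrakk>x \<in> Ob C; y \<in> Ob C\<rbrakk>
      \<Longrightarrow> bij_betw (ShA C) (Hom C x y) (Hom C (ShO C x) (ShO C y))"
    and ShA_Id: "x \<in> Ob C \<Longrightarrow> ShA C (Id C x) = Id C (ShO C x)"
    and ShA_Comp: "\<lbrakk>f \<in> Hom C x y; g \<in> Hom C y z\<rbrakk> \<Longrightarrow> ShA C (g \<cdot> f) = ShA C g \<cdot> ShA C f"
    and ShA_Add: "\<lbrakk>f \<in> Hom C x y; g \<in> Hom C x y\<rbrakk>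
      \<Longrightarrow> ShA C (Add C f g) = Add C (ShA C f) (ShA C g)"
    and Sh_surj: "y \<in> Ob C \<Longrightarrow> \<exists>x \<in> Ob C. isomorphic C (ShO C x) y"
    and Tri_triangle: "(f, g, h) \<in> Tri C \<Longrightarrow> triangle C f g h"
    and Tri_Id: "\<lbrakk>x \<in> Ob C; zero_object C z\<rbrakk>
      \<Longrightarrow> (Id C x, Zero C x z, Zero C z (ShO C x)) \<in> Tri C"
    and Tri_ex: "f \<in> Arr C \<Longrightarrow> \<exists>g h. (f, g, h) \<in> Tri C"
    and Tri_iso: "\<lbrakk>(f, g, h) \<in> Tri C; triangle C f' g' h';
        a \<in> Hom C (Dom C f) (Dom C f'); b \<in> Hom C (Dom C g) (Dom C g');
        c \<in> Hom C (Dom C h) (Dom C h');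
        isomorphism C a; isomorphism C b; isomorphism C c;
        b \<cdot> f = f' \<cdot> a; c \<cdot> g = g' \<cdot> b; ShA C a \<cdot> h = h' \<cdot> c\<rbrakk> \<Longrightarrow> (f', g', h') \<in> Tri C"
    and Tri_rotate: "triangle C f g h
      \<Longrightarrow> (f, g, h) \<in> Tri C \<longleftrightarrow> (g, h, Neg C (ShA C f)) \<in> Tri C"
    and Tri_morphism: "\<lbrakk>(f, g, h) \<in> Tri C; (f', g', h') \<in> Tri C;
        a \<in> Hom C (Dom C f) (Dom C f'); b \<in> Hom C (Dom C g) (Dom C g'); b \<cdot> f = f' \<cdot> a\<rbrakk>
      \<Longrightarrow> \<exists>c \<in> Hom C (Dom C h) (Dom C h'). c \<cdot> g = g' \<cdot> b \<and> ShA C a \<cdot> h = h' \<cdot> c"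
    and Tri_octahedral: "\<lbrakk>Cod C f = Dom C g; (f, f1, f2) \<in> Tri C; (g, g1, g2) \<in> Tri C;
        (g \<cdot> f, h1, h2) \<in> Tri C\<rbrakk>
      \<Longrightarrow> \<exists>u \<in> Hom C (Cod C f1) (Cod C h1). \<exists>v \<in> Hom C (Cod C h1) (Cod C g1).
            (u, v, ShA C f1 \<cdot> g2) \<in> Tri C \<and> u \<cdot> f1 = h1 \<cdot> g \<and> h2 \<cdot> u = f2 \<and>
            v \<cdot> h1 = g1 \<and> g2 \<cdot> v = ShA C f \<cdot> h2"

text \<open>\<open>K(C)\<close> is the free abelian group on the objects modulo the relations
  \<open>[y] = [x] + [z]\<close> for all distinguished triangles \<open>x \<rightarrow> y \<rightarrow> z \<rightarrow> x[1]\<close>.\<close>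

definition K_relations :: "('o, 'm, 'e) tricat_scheme \<Rightarrow> ('o \<Rightarrow>\<^sub>0 int) set" where
  "K_relations C = generate (free_Abelian_group (Ob C))
     {frag_of (Cod C f) - frag_of (Dom C f) - frag_of (Cod C g) | f g h. (f, g, h) \<in> Tri C}"

definition K_group :: "('o, 'm, 'e) tricat_scheme \<Rightarrow> ('o \<Rightarrow>\<^sub>0 int) set monoid" where
  "K_group C = free_Abelian_group (Ob C) Mod K_relations C"

definition K_class :: "('o, 'm, 'e) tricat_scheme \<Rightarrow> 'o \<Rightarrow> ('o \<Rightarrow>\<^sub>0 int) set" where
  "K_class C x = K_relations C #>\<^bsub>free_Abelian_group (Ob C)\<^esub> frag_of x"

definition complex_group :: "complex monoid" where
  "complex_group = \<lparr>carrier = UNIV, monoid.mult = (+), one = 0\<rparr>"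


section \<open>Stability conditions\<close>

text \<open>A filtration \<open>0 = E 0 \<rightarrow> E 1 \<rightarrow> \<dots> \<rightarrow> E n = x\<close> whose successive cones \<open>A 0, \<dots>, A (n - 1)\<close> are
  nonzero objects of \<open>P (\<phi> 0), \<dots>, P (\<phi> (n - 1))\<close>, of strictly decreasing phases.\<close>

definition HN_filtration ::
  "('o, 'm, 'e) tricat_scheme \<Rightarrow> (real \<Rightarrow> 'o set) \<Rightarrow> 'o \<Rightarrow>
   nat \<Rightarrow> (nat \<Rightarrow> 'o) \<Rightarrow> (nat \<Rightarrow> real) \<Rightarrow> (nat \<Rightarrow> 'o) \<Rightarrow> bool" where
  "HN_filtration C P x n E \<phi> A \<longleftrightarrow>
     zero_object C (E 0) \<and> E n = x \<and>
     (\<forall>j < n. A j \<in> P (\<phi> j) \<and> \<not> zero_object C (A j) \<and>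
        (\<exists>f g h. (f, g, h) \<in> Tri C \<and>
           f \<in> Hom C (E j) (E (Suc j)) \<and> g \<in> Hom C (E (Suc j)) (A j))) \<and>
     (\<forall>i j. i < j \<and> j < n \<longrightarrow> \<phi> i > \<phi> j)"

text \<open>The subcategories \<open>P \<phi>\<close> are full and closed under isomorphism, so they are given by their
  sets of objects.  As the shift need not be surjective on objects, \<open>P (\<phi> + 1) = P \<phi>[1]\<close> is
  understood up to isomorphism of objects.\<close>

definition slicing :: "('o, 'm, 'e) tricat_scheme \<Rightarrow> (real \<Rightarrow> 'o set) \<Rightarrow> bool" where
  "slicing C P \<longleftrightarrow>
     (\<forall>\<phi>. P \<phi> \<subseteq> Ob C \<and> additive_category (full_subcat C (P \<phi>)) \<and>
          (\<forall>x \<in> P \<phi>. \<forall>y \<in> Ob C. isomorphic C x y \<longrightarrow> y \<in> P \<phi>)) \<and>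
     (\<forall>\<phi>. P (\<phi> + 1) = {y \<in> Ob C. \<exists>x \<in> P \<phi>. isomorphic C (ShO C x) y}) \<and>
     (\<forall>\<phi> \<psi>. \<phi> > \<psi> \<longrightarrow> (\<forall>x \<in> P \<phi>. \<forall>y \<in> P \<psi>. Hom C x y = {Zero C x y})) \<and>
     (\<forall>x \<in> Ob C. \<not> zero_object C x \<longrightarrow> (\<exists>n E \<phi> A. HN_filtration C P x n E \<phi> A))"

inductive_set extension_closure :: "('o, 'm, 'e) tricat_scheme \<Rightarrow> 'o set \<Rightarrow> 'o set"
  for C :: "('o, 'm, 'e) tricat_scheme" and S :: "'o set" where
  base: "x \<in> S \<Longrightarrow> x \<in> extension_closure C S"
| extension: "\<lbrakk>(f, g, h) \<in> Tri C; Dom C f \<in> extension_closure C S;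
    Cod C g \<in> extension_closure C S\<rbrakk> \<Longrightarrow> Cod C f \<in> extension_closure C S"

text \<open>Local finiteness in the sense of Bridgeland.  The categories \<open>P((t - \<eta>, t + \<eta>))\<close> are
  quasi-abelian because the interval has length less than one; this is why \<open>\<eta> < 1/2\<close> is
  part of the definition.  Replacing \<open>\<eta>\<close> by a smaller positive number is harmless.\<close>

definition locally_finite :: "('o, 'm, 'e) tricat_scheme \<Rightarrow> (real \<Rightarrow> 'o set) \<Rightarrow> bool" where
  "locally_finite C P \<longleftrightarrow> (\<exists>\<eta>. 0 < \<eta> \<and> \<eta> < 1/2 \<and>
     (\<forall>t. finite_length
        (full_subcat C (extension_closure C (\<Union>\<phi> \<in> {t - \<eta> <..< t + \<eta>}. P \<phi>)))))"

type_synonym 'o stability_data = "(real \<Rightarrow> 'o set) \<times> (('o \<Rightarrow>\<^sub>0 int) set \<Rightarrow> complex)"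

definition stability_condition :: "('o, 'm, 'e) tricat_scheme \<Rightarrow> 'o stability_data \<Rightarrow> bool" where
  "stability_condition C \<tau> \<longleftrightarrow> (case \<tau> of (P, Z) \<Rightarrow>
     slicing C P \<and> Z \<in> hom (K_group C) complex_group \<and>
     (\<forall>\<phi>. \<forall>a \<in> P \<phi>. \<not> zero_object C a \<longrightarrow>
        (\<exists>r > 0. Z (K_class C a) = of_real r * exp (\<i> * of_real pi * of_real \<phi>))))"

definition locally_finite_stability_condition ::
  "('o, 'm, 'e) tricat_scheme \<Rightarrow> 'o stability_data \<Rightarrow> bool" where
  "locally_finite_stability_condition C \<tau> \<longleftrightarrow>
     stability_condition C \<tau> \<and> locally_finite C (fst \<tau>)"

definition stable_object :: "('o, 'm, 'e) tricat_scheme \<Rightarrow> 'o stability_data \<Rightarrow> 'o \<Rightarrow> bool" where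
  "stable_object C \<tau> x \<longleftrightarrow> (\<exists>\<phi>. simple_object (full_subcat C (fst \<tau> \<phi>)) x)"

text \<open>The description is proper since the phases and, up to isomorphism, the factors of a
  Harder--Narasimhan filtration are unique.\<close>

definition mass :: "('o, 'm, 'e) tricat_scheme \<Rightarrow> real \<Rightarrow> 'o stability_data \<Rightarrow> 'o \<Rightarrow> real" where
  "mass C q \<tau> x = (case \<tau> of (P, Z) \<Rightarrow>
     if zero_object C x then 0
     else (THE m. \<exists>n E \<phi> A. HN_filtration C P x n E \<phi> A \<and>
             m = (\<Sum>j<n. q powr \<phi> j * cmod (Z (K_class C (A j))))))"

end

theory Submission
  imports Defs
begin

text \<open>
  An object \<open>x\<close> turns out to be stable if and only if it is nonzero and \<open>m(x) < m(a) + m(b)\<close> for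
  all triangles \<open>a \<rightarrow> x \<rightarrow> b \<rightarrow> a[1]\<close> with \<open>a\<close>, \<open>b\<close> nonzero, so stability is determined by the mass.

  If \<open>x\<close> is not semistable, the last step of its Harder--Narasimhan filtration gives a triangle with
  equality; if \<open>x\<close> is semistable but not simple, so does a proper subobject, because the cone of a
  monomorphism of \<open>P \<phi>\<close> lies in \<open>P \<phi>\<close>.

  Conversely let \<open>x\<close> be stable of phase \<open>\<phi>\<close>.  The function \<open>q\<^sup>\<psi> \<bar>z\<bar>\<close>, where \<open>\<psi>\<close> is the phase of \<open>z\<close>,
  has a linear support functional \<open>L\<close> at phase \<open>\<phi>\<close>, with \<open>L z < q\<^sup>\<psi> \<bar>z\<bar>\<close> for \<open>0 < \<bar>\<psi> - \<phi>\<bar> \<le> 1\<close>.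
  The connecting map \<open>b \<rightarrow> a[1]\<close> induces isomorphisms between the parts of phase \<open>> \<phi> + 1\<close> and between
  the parts of phase \<open>< \<phi>\<close>, so the corresponding factors of \<open>a\<close> and \<open>b\<close> cancel in the Grothendieck
  group and \<open>m(x) = L(x)\<close> is the sum of \<open>L\<close> over the remaining factors, whose phases differ from
  \<open>\<phi>\<close> by at most one.  Equality forces \<open>a\<close> and \<open>b\<close> into \<open>P \<phi>\<close>, where \<open>x\<close> is simple.
\<close>

section \<open>Additive and triangulated categories\<close>

context category
begin

lemma Hom_Ob: "f \<in> Hom C x y \<Longrightarrow> x \<in> Ob C" "f \<in> Hom C x y \<Longrightarrow> y \<in> Ob C"
  using Dom_closed Cod_closed by (auto simp: Hom_def)

lemma isomorphicI:
  assumes "f \<in> Hom C x y" "g \<in> Hom C y x" "g \<cdot> f = Id C x" "f \<cdot> g = Id C y"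
  shows "isomorphism C f" "isomorphic C x y"
proof -
  have "Dom C f = x" "Cod C f = y" "f \<in> Arr C"
    using assms by (auto simp: Hom_def)
  then show "isomorphism C f"
    using assms unfolding isomorphism_def by auto
  then show "isomorphic C x y"
    using assms unfolding isomorphic_def by auto
qed

lemma isomorphismE:
  assumes "isomorphism C f" "f \<in> Hom C x y"
  obtains g where "g \<in> Hom C y x" "g \<cdot> f = Id C x" "f \<cdot> g = Id C y"
  using assms unfolding isomorphism_def Hom_def by auto

lemma isomorphic_refl: "x \<in> Ob C \<Longrightarrow> isomorphic C x x"
  using isomorphicI(2)[OF Id_closed Id_closed] Comp_Id Id_closed by metis

lemma isomorphic_sym: "isomorphic C x y \<Longrightarrow> isomorphic C y x"
  using isomorphicI(2) isomorphismE unfolding isomorphic_def by metis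

end

section \<open>Zero morphisms and negatives\<close>

context additive_category
begin

lemma Zero_closed: "\<lbrakk>x \<in> Ob C; y \<in> Ob C\<rbrakk> \<Longrightarrow> Zero C x y \<in> Hom C x y"
  using comm_group.axioms(2)[OF hom_group, THEN group.is_monoid, THEN monoid.one_closed]
  by (simp add: hom_group_def)

lemma Add_closed: "\<lbrakk>f \<in> Hom C x y; g \<in> Hom C x y\<rbrakk> \<Longrightarrow> Add C f g \<in> Hom C x y"
  using comm_group.axioms(2)[OF hom_group, THEN group.is_monoid, THEN monoid.m_closed, of x y f g]
    Hom_Ob by (fastforce simp: hom_group_def)

lemma Add_Zero: "f \<in> Hom C x y \<Longrightarrow> Add C f (Zero C x y) = f"
  using comm_group.axioms(2)[OF hom_group, THEN group.is_monoid, THEN monoid.r_one, of x y f]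
    Hom_Ob by (fastforce simp: hom_group_def)

lemma Add_idem_Zero:
  assumes "f \<in> Hom C x y" "Add C f f = f"
  shows "f = Zero C x y"
proof -
  interpret G: comm_group "hom_group C x y"
    using assms hom_group Hom_Ob by metis
  show ?thesis
    using G.l_cancel_one[of f f] assms by (simp add: hom_group_def)
qed

lemma Neg_unique:
  assumes "f \<in> Hom C x y" "g \<in> Hom C x y"
  shows "Add C f g = Zero C x y \<longleftrightarrow> g = Neg C f"
proof -
  interpret G: comm_group "hom_group C x y"
    using assms hom_group Hom_Ob by metis
  have D: "Dom C f = x" "Cod C f = y"
    using assms by (auto simp: Hom_def)
  have "f \<otimes>\<^bsub>hom_group C x y\<^esub> g = \<one>\<^bsub>hom_group C x y\<^esub> \<longleftrightarrow> g = inv\<^bsub>hom_group C x y\<^esub> f"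
    using G.r_inv G.inv_equality[of g f] G.m_comm[of f g] assms by (auto simp: hom_group_def)
  then show ?thesis
    unfolding Neg_def D by (simp add: hom_group_def)
qed

lemma Neg_closed: "f \<in> Hom C x y \<Longrightarrow> Neg C f \<in> Hom C x y"
proof -
  assume f: "f \<in> Hom C x y"
  interpret G: comm_group "hom_group C x y"
    using f hom_group Hom_Ob by metis
  have D: "Dom C f = x" "Cod C f = y"
    using f by (auto simp: Hom_def)
  show ?thesis
    using G.inv_closed[of f] f unfolding Neg_def D by (simp add: hom_group_def)
qed

lemma Add_Neg: "f \<in> Hom C x y \<Longrightarrow> Add C f (Neg C f) = Zero C x y"
  using Neg_unique[OF _ Neg_closed] by blast

lemma Add_commute: "\<lbrakk>f \<in> Hom C x y; g \<in> Hom C x y\<rbrakk> \<Longrightarrow> Add C f g = Add C g f"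
proof -
  assume f: "f \<in> Hom C x y" "g \<in> Hom C x y"
  interpret G: comm_group "hom_group C x y"
    using f hom_group Hom_Ob by metis
  show ?thesis using G.m_comm[of f g] f by (simp add: hom_group_def)
qed

lemma Neg_Neg: "f \<in> Hom C x y \<Longrightarrow> Neg C (Neg C f) = f"
  using Neg_unique[OF Neg_closed, of f x y f] Add_commute[OF Neg_closed, of f x y f] Add_Neg
  by metis

lemma Neg_Zero: "\<lbrakk>x \<in> Ob C; y \<in> Ob C\<rbrakk> \<Longrightarrow> Neg C (Zero C x y) = Zero C x y"
  using Neg_unique[OF Zero_closed Zero_closed, of x y] Add_Zero[OF Zero_closed] by metis

lemma Comp_Zero:
  assumes "f \<in> Hom C x y" "w \<in> Ob C"
  shows "f \<cdot> Zero C w x = Zero C w y"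
proof (rule Add_idem_Zero)
  have z: "Zero C w x \<in> Hom C w x"
    using assms Zero_closed Hom_Ob by metis
  then show "f \<cdot> Zero C w x \<in> Hom C w y"
    using assms Comp_closed by blast
  show "Add C (f \<cdot> Zero C w x) (f \<cdot> Zero C w x) = f \<cdot> Zero C w x"
    using Comp_Add_right[OF z z assms(1)] Add_Zero[OF z] by simp
qed

lemma Zero_Comp:
  assumes "f \<in> Hom C x y" "w \<in> Ob C"
  shows "Zero C y w \<cdot> f = Zero C x w"
proof (rule Add_idem_Zero)
  have z: "Zero C y w \<in> Hom C y w"
    using assms Zero_closed Hom_Ob by metis
  then show "Zero C y w \<cdot> f \<in> Hom C x w"
    using assms Comp_closed by blast
  show "Add C (Zero C y w \<cdot> f) (Zero C y w \<cdot> f) = Zero C y w \<cdot> f"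
    using Comp_Add_left[OF assms(1) z z] Add_Zero[OF z] by simp
qed

lemma Neg_Comp:
  assumes "f \<in> Hom C x y" "g \<in> Hom C y z"
  shows "Neg C g \<cdot> f = Neg C (g \<cdot> f)"
proof -
  have "Add C (g \<cdot> f) (Neg C g \<cdot> f) = Zero C x z"
    using Comp_Add_left[OF assms(1) assms(2) Neg_closed[OF assms(2)]] Add_Neg[OF assms(2)]
      Zero_Comp[OF assms(1)] assms Hom_Ob by metis
  then show ?thesis
    using Neg_unique assms Comp_closed Neg_closed by metis
qed

lemma Comp_Neg:
  assumes "f \<in> Hom C x y" "g \<in> Hom C y z"
  shows "g \<cdot> Neg C f = Neg C (g \<cdot> f)"
proof -
  have "Add C (g \<cdot> f) (g \<cdot> Neg C f) = Zero C x z"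
    using Comp_Add_right[OF assms(1) Neg_closed[OF assms(1)] assms(2)] Add_Neg[OF assms(1)]
      Comp_Zero[OF assms(2)] assms Hom_Ob by metis
  then show ?thesis
    using Neg_unique assms Comp_closed Neg_closed by metis
qed

lemma Neg_eq_Zero: "f \<in> Hom C x y \<Longrightarrow> Neg C f = Zero C x y \<longleftrightarrow> f = Zero C x y"
  using Neg_Neg Neg_Zero Hom_Ob by metis

lemma zero_object_iff: "zero_object C z \<longleftrightarrow> z \<in> Ob C \<and> Id C z = Zero C z z"
proof
  assume "zero_object C z"
  then show "z \<in> Ob C \<and> Id C z = Zero C z z"
    using Id_closed Zero_closed unfolding zero_object_def by metis
next
  assume z: "z \<in> Ob C \<and> Id C z = Zero C z z"
  have "f = Zero C z x" if "f \<in> Hom C z x" for f x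
    using Comp_Id[OF that] Comp_Zero[OF that] z by metis
  moreover have "f = Zero C x z" if "f \<in> Hom C x z" for f x
    using Id_Comp[OF that] Zero_Comp[OF that] z by metis
  ultimately show "zero_object C z"
    unfolding zero_object_def using z Zero_closed by metis
qed

lemma zero_object_Hom:
  assumes "zero_object C z"
  shows "f \<in> Hom C z x \<Longrightarrow> f = Zero C z x" "f \<in> Hom C x z \<Longrightarrow> f = Zero C x z"
  using assms Zero_closed Hom_Ob unfolding zero_object_def by metis+

lemma Zero_factor:
  assumes "zero_object C y" "f \<in> Hom C x y" "g \<in> Hom C y z"
  shows "g \<cdot> f = Zero C x z"
  using assms zero_object_Hom Comp_Zero Hom_Ob by metis

end

section \<open>Exactness of Hom along distinguished triangles\<close>

context triangulated_category
begin

text \<open>Elements of \<open>Tri C\<close> consist of morphisms only; naming the three objects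
  avoids equations between domains and codomains.\<close>

definition dtri :: "'o \<Rightarrow> 'o \<Rightarrow> 'o \<Rightarrow> 'm \<Rightarrow> 'm \<Rightarrow> 'm \<Rightarrow> bool" where
  "dtri x y z f g h \<longleftrightarrow> (f, g, h) \<in> Tri C \<and> f \<in> Hom C x y \<and> g \<in> Hom C y z \<and> h \<in> Hom C z (ShO C x)"

lemma dtri_Hom:
  assumes "dtri x y z f g h"
  shows "f \<in> Hom C x y" "g \<in> Hom C y z" "h \<in> Hom C z (ShO C x)"
    "x \<in> Ob C" "y \<in> Ob C" "z \<in> Ob C"
  using assms Hom_Ob unfolding dtri_def by blast+

lemma triangle_iff:
  "triangle C f g h \<longleftrightarrow>
    (\<exists>x y z. f \<in> Hom C x y \<and> g \<in> Hom C y z \<and> h \<in> Hom C z (ShO C x))"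
  by (auto simp: triangle_def Hom_def)

lemma Tri_dtri: "(f, g, h) \<in> Tri C \<Longrightarrow> dtri (Dom C f) (Cod C f) (Cod C g) f g h"
  using Tri_triangle unfolding dtri_def triangle_def Hom_def by fastforce

lemma Tri_dtriI:
  assumes "(f, g, h) \<in> Tri C" "f \<in> Hom C x y" "g \<in> Hom C y' z"
  shows "dtri x y z f g h"
  using Tri_dtri[OF assms(1)] assms(2,3) by (auto simp: Hom_def)

lemma ShA_closed: "f \<in> Hom C x y \<Longrightarrow> ShA C f \<in> Hom C (ShO C x) (ShO C y)"
  using ShA_bij[of x y] Hom_Ob[of f x y] by (auto simp: bij_betw_def)

lemma ShA_inj: "\<lbrakk>f \<in> Hom C x y; g \<in> Hom C x y; ShA C f = ShA C g\<rbrakk> \<Longrightarrow> f = g"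
  using ShA_bij[of x y] Hom_Ob[of f x y] by (auto simp: bij_betw_def inj_on_def)

lemma ShA_surjE:
  assumes "f \<in> Hom C (ShO C x) (ShO C y)" "x \<in> Ob C" "y \<in> Ob C"
  obtains g where "g \<in> Hom C x y" "f = ShA C g"
  using ShA_bij[of x y] assms by (auto simp: bij_betw_def)

lemma ShA_Zero: "\<lbrakk>x \<in> Ob C; y \<in> Ob C\<rbrakk> \<Longrightarrow> ShA C (Zero C x y) = Zero C (ShO C x) (ShO C y)"
  using Add_idem_Zero[OF ShA_closed[OF Zero_closed]] ShA_Add[OF Zero_closed Zero_closed]
    Add_Zero[OF Zero_closed] by metis

lemma ShA_eq_Zero: "f \<in> Hom C x y \<Longrightarrow> ShA C f = Zero C (ShO C x) (ShO C y) \<longleftrightarrow> f = Zero C x y"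
  using ShA_inj ShA_Zero Zero_closed Hom_Ob by metis

lemma zero_object_ShO: "zero_object C z \<Longrightarrow> zero_object C (ShO C z)"
  using zero_object_iff ShO_closed ShA_Id ShA_Zero by metis

lemma dtri_rotate:
  "dtri x y z f g h \<Longrightarrow> dtri y z (ShO C x) g h (Neg C (ShA C f))"
  using Tri_rotate[of f g h] Neg_closed[OF ShA_closed] unfolding dtri_def triangle_iff by blast

lemma dtri_shift:
  "dtri x y z f g h \<Longrightarrow>
    dtri (ShO C x) (ShO C y) (ShO C z) (Neg C (ShA C f)) (Neg C (ShA C g)) (Neg C (ShA C h))"
  using dtri_rotate by blast

lemma dtri_Id:
  assumes "x \<in> Ob C" "zero_object C z"
  shows "dtri x x z (Id C x) (Zero C x z) (Zero C z (ShO C x))"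
  using Tri_Id[OF assms] assms Id_closed Zero_closed ShO_closed zero_object_iff
  unfolding dtri_def by metis

lemma dtri_zero_Id:
  assumes x: "x \<in> Ob C" and z: "zero_object C z"
  shows "dtri z x x (Zero C z x) (Id C x) (Zero C x (ShO C z))"
proof -
  have *: "Zero C z x \<in> Hom C z x" "Id C x \<in> Hom C x x" "Zero C x (ShO C z) \<in> Hom C x (ShO C z)"
    using assms Id_closed Zero_closed ShO_closed zero_object_iff by metis+
  have "Neg C (ShA C (Zero C z x)) = Zero C (ShO C z) (ShO C x)"
    using ShA_Zero Neg_Zero ShO_closed assms zero_object_iff by metis
  \<comment> \<open>The identity triangle with the zero object \<open>ShO C z\<close> as its cone.
    Its last map is also the negative of the shifted zero map, so it is the rotation of the desired
    triangle.\<close>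
  then have "(Id C x, Zero C x (ShO C z), Neg C (ShA C (Zero C z x))) \<in> Tri C"
    using Tri_Id[OF x zero_object_ShO[OF z]] by simp
  then show ?thesis
    using Tri_rotate * unfolding dtri_def triangle_iff by metis
qed

lemma dtri_ex:
  assumes "f \<in> Hom C x y"
  obtains z g h where "dtri x y z f g h"
proof -
  obtain g h where "(f, g, h) \<in> Tri C"
    using Tri_ex[of f] assms unfolding Hom_def by blast
  then have "dtri (Dom C f) (Cod C f) (Cod C g) f g h"
    by (rule Tri_dtri)
  moreover have "Dom C f = x" "Cod C f = y"
    using assms by (auto simp: Hom_def)
  ultimately show ?thesis
    using that by metis
qed

lemma dtri_morphism:
  assumes "dtri x y z f g h" "dtri x' y' z' f' g' h'"
    and "a \<in> Hom C x x'" "b \<in> Hom C y y'" "b \<cdot> f = f' \<cdot> a"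
  obtains c where "c \<in> Hom C z z'" "c \<cdot> g = g' \<cdot> b" "ShA C a \<cdot> h = h' \<cdot> c"
proof -
  have D: "Dom C f = x" "Dom C f' = x'" "Dom C g = y" "Dom C g' = y'" "Dom C h = z" "Dom C h' = z'"
    using assms by (auto simp: Hom_def dtri_def)
  show ?thesis
    using Tri_morphism[of f g h f' g' h' a b] assms that unfolding D dtri_def by blast
qed

text \<open>The identity triangle of \<open>x\<close> maps to the given one by \<open>Id C x\<close>
  and \<open>f\<close>, so \<open>g \<cdot> f\<close> factors through a zero object. Rotation yields
  the second composite.\<close>

lemma dtri_comp:
  assumes "dtri x y z f g h"
  shows "g \<cdot> f = Zero C x z" "h \<cdot> g = Zero C y (ShO C x)"
proof -
  have *: "g \<cdot> f = Zero C x z" if d: "dtri x y z f g h" for x y z f g h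
  proof -
    obtain e where e: "zero_object C e"
      using ex_zero_object by blast
    have x: "x \<in> Ob C"
      using dtri_Hom[OF d] by simp
    obtain c where c: "c \<in> Hom C e z" "c \<cdot> Zero C x e = g \<cdot> f"
      using dtri_morphism[OF dtri_Id[OF x e] d Id_closed[OF x] dtri_Hom(1)[OF d]] by blast
    then show ?thesis
      using Comp_Zero x by metis
  qed
  show "g \<cdot> f = Zero C x z" "h \<cdot> g = Zero C y (ShO C x)"
    using *[OF assms] *[OF dtri_rotate[OF assms]] by auto
qed

lemma dtri_comp_ShA:
  assumes "dtri x y z f g h"
  shows "ShA C f \<cdot> h = Zero C z (ShO C y)"
proof -
  have h: "h \<in> Hom C z (ShO C x)" and f: "ShA C f \<in> Hom C (ShO C x) (ShO C y)"
    using dtri_Hom[OF assms] ShA_closed by auto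
  then show ?thesis
    using dtri_comp(2)[OF dtri_rotate[OF assms]] Neg_Comp[OF h f] Neg_eq_Zero Comp_closed by metis
qed

text \<open>The axiom on morphisms of triangles only fills in a third map, so the identity triangle
  of \<open>w\<close> and the given one are rotated first. The third map then goes from
  \<open>ShO C w\<close> to \<open>ShO C x\<close>, and fullness of the shift turns it into a map
  \<open>w -> x\<close>.\<close>

lemma dtri_lift:
  assumes d: "dtri x y z f g h" and u: "u \<in> Hom C w y" "g \<cdot> u = Zero C w z"
  obtains v where "v \<in> Hom C w x" "u = f \<cdot> v"
proof -
  obtain e where e: "zero_object C e"
    using ex_zero_object by blast
  have w: "w \<in> Ob C"
    using u Hom_Ob by blast
  note H = dtri_Hom[OF d]
  have z: "Zero C e z \<in> Hom C e z"
    using e H Zero_closed zero_object_iff by metis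
  have "Zero C e z \<cdot> Zero C w e = g \<cdot> u"
    using u(2) e w z Zero_factor[OF e _ z] Zero_closed zero_object_iff by metis
  then obtain c where c: "c \<in> Hom C (ShO C w) (ShO C x)"
      "ShA C u \<cdot> Neg C (ShA C (Id C w)) = Neg C (ShA C f) \<cdot> c"
    using dtri_morphism[OF dtri_rotate[OF dtri_Id[OF w e]] dtri_rotate[OF d] u(1) z] by blast
  then obtain v where v: "v \<in> Hom C w x" "c = ShA C v"
    using ShA_surjE H w by metis
  have "Neg C (ShA C u) = ShA C u \<cdot> Neg C (ShA C (Id C w))"
    using Comp_Neg[OF ShA_closed[OF Id_closed[OF w]] ShA_closed[OF u(1)]]
      ShA_Id[OF w] Comp_Id[OF ShA_closed[OF u(1)]] by metis
  also have "\<dots> = Neg C (ShA C f \<cdot> ShA C v)"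
    using c v Neg_Comp[OF c(1) ShA_closed[OF H(1)]] by simp
  finally have "ShA C u = ShA C (f \<cdot> v)"
    using Neg_Neg ShA_closed Comp_closed ShA_Comp H(1) v(1) u(1) by metis
  then have "u = f \<cdot> v"
    using ShA_inj u(1) Comp_closed H(1) v(1) by metis
  then show ?thesis
    using v that by blast
qed

text \<open>Dually, \<open>u\<close> and the zero map \<open>x -> e\<close> form a square into the
  triangle \<open>e -> w -> w\<close>, and the third map that completes it is the extension.\<close>

lemma dtri_extend:
  assumes d: "dtri x y z f g h" and u: "u \<in> Hom C y w" "u \<cdot> f = Zero C x w"
  obtains v where "v \<in> Hom C z w" "u = v \<cdot> g"
proof -
  obtain e where e: "zero_object C e"
    using ex_zero_object by blast
  have w: "w \<in> Ob C"
    using u Hom_Ob by blast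
  note H = dtri_Hom[OF d]
  have z: "Zero C x e \<in> Hom C x e"
    using e H Zero_closed zero_object_iff by metis
  have "u \<cdot> f = Zero C e w \<cdot> Zero C x e"
    using u(2) e w z Zero_factor[OF e z] Zero_closed zero_object_iff by metis
  then obtain c where "c \<in> Hom C z w" "c \<cdot> g = Id C w \<cdot> u"
    using dtri_morphism[OF d dtri_zero_Id[OF w e] z u(1)] by blast
  then show ?thesis
    using that Id_Comp[OF u(1)] by metis
qed

text \<open>Two rotations turn \<open>f\<close> into \<open>Neg C (ShA C f)\<close>. The sign does
  not affect which maps are killed, and in \<open>dtri_extend2\<close> it is absorbed into the
  factor.\<close>

lemma dtri_lift2:
  assumes d: "dtri x y z f g h" and u: "u \<in> Hom C w (ShO C x)" "ShA C f \<cdot> u = Zero C w (ShO C y)"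
  obtains v where "v \<in> Hom C w z" "u = h \<cdot> v"
proof (rule dtri_lift[OF dtri_rotate[OF dtri_rotate[OF d]] u(1)])
  note f = ShA_closed[OF dtri_Hom(1)[OF d]]
  show "Neg C (ShA C f) \<cdot> u = Zero C w (ShO C y)"
    using Neg_Comp[OF u(1) f] u Neg_eq_Zero[OF Comp_closed[OF u(1) f]] by simp
qed (use that in auto)

lemma dtri_extend2:
  assumes d: "dtri x y z f g h" and u: "u \<in> Hom C (ShO C x) w" "u \<cdot> h = Zero C z w"
  obtains v where "v \<in> Hom C (ShO C y) w" "u = v \<cdot> ShA C f"
proof (rule dtri_extend[OF dtri_rotate[OF dtri_rotate[OF d]] u])
  fix v assume v: "v \<in> Hom C (ShO C y) w" "u = v \<cdot> Neg C (ShA C f)"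
  note f = ShA_closed[OF dtri_Hom(1)[OF d]]
  have "u = Neg C v \<cdot> ShA C f"
    using v Comp_Neg[OF f v(1)] Neg_Comp[OF f v(1)] by simp
  then show thesis
    using that Neg_closed[OF v(1)] by blast
qed

text \<open>An inverse of \<open>f\<close> forces \<open>g\<close> and \<open>h\<close> to vanish;
  then \<open>Id C z\<close> lifts through \<open>g\<close> and is zero. Conversely, with
  \<open>z\<close> zero, lifting \<open>Id C y\<close> gives a right inverse of \<open>f\<close>,
  extending the shifted identity of \<open>x\<close> gives a left inverse, and the two
  agree.\<close>

lemma dtri_iso_zero:
  assumes "dtri x y z f g h"
  shows "isomorphism C f \<longleftrightarrow> zero_object C z"
proof
  assume f: "isomorphism C f"
  note H = dtri_Hom[OF assms]
  obtain f' where f': "f' \<in> Hom C y x" "f' \<cdot> f = Id C x" "f \<cdot> f' = Id C y"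
    using isomorphismE[OF f H(1)] .
  have "g = g \<cdot> (f \<cdot> f')"
    using f' Comp_Id[OF H(2)] by simp
  also have "\<dots> = Zero C x z \<cdot> f'"
    using Comp_assoc[OF f'(1) H(1,2)] dtri_comp(1)[OF assms] by simp
  finally have g: "g = Zero C y z"
    using Zero_Comp f' H by metis
  have "ShA C f' \<cdot> (ShA C f \<cdot> h) = Zero C z (ShO C x)"
    using dtri_comp_ShA[OF assms] Comp_Zero[OF ShA_closed[OF f'(1)] H(6)] by simp
  then have "h = Zero C z (ShO C x)"
    using Comp_assoc[OF H(3) ShA_closed[OF H(1)] ShA_closed[OF f'(1)]]
      ShA_Comp[OF H(1) f'(1)] f' ShA_Id[OF H(4)] Id_Comp[OF H(3)] by metis
  then have "h \<cdot> Id C z = Zero C z (ShO C x)"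
    using Comp_Id H(3) by simp
  then obtain v where "v \<in> Hom C z y" "Id C z = g \<cdot> v"
    using dtri_lift[OF dtri_rotate[OF assms] Id_closed[OF H(6)]] by metis
  then show "zero_object C z"
    using g Zero_Comp H zero_object_iff by metis
next
  assume z: "zero_object C z"
  note H = dtri_Hom[OF assms]
  have "g \<cdot> Id C y = Zero C y z"
    using zero_object_Hom(2)[OF z H(2)] Comp_Id[OF H(2)] by simp
  then obtain v where v: "v \<in> Hom C y x" "Id C y = f \<cdot> v"
    using dtri_lift[OF assms Id_closed[OF H(5)]] by metis
  have "ShA C (Id C x) \<cdot> h = Zero C z (ShO C x)"
    using Comp_closed[OF H(3) ShA_closed[OF Id_closed[OF H(4)]]] zero_object_Hom(1)[OF z] by simp
  then obtain w where w: "w \<in> Hom C (ShO C y) (ShO C x)" "ShA C (Id C x) = w \<cdot> ShA C f"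
    using dtri_extend2[OF assms ShA_closed[OF Id_closed[OF H(4)]]] by metis
  then obtain w' where w': "w' \<in> Hom C y x" "w = ShA C w'"
    using ShA_surjE H by metis
  then have "ShA C (Id C x) = ShA C (w' \<cdot> f)"
    using w ShA_Comp H by metis
  then have 1: "w' \<cdot> f = Id C x"
    using ShA_inj[OF Id_closed[OF H(4)] Comp_closed[OF H(1) w'(1)]] by simp
  then have "w' = v"
    using Comp_assoc[OF v(1) H(1) w'(1)] v Comp_Id[OF w'(1)] Id_Comp[OF v(1)] by simp
  then show "isomorphism C f"
    using isomorphicI[OF H(1) v(1)] 1 v by simp
qed

lemma dtri_zero_isomorphic:
  assumes "dtri x y z f g h" "zero_object C x"
  shows "isomorphic C y z"
  using dtri_iso_zero[OF dtri_rotate[OF assms(1)]] zero_object_ShO[OF assms(2)] dtri_Hom[OF assms(1)]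
  unfolding isomorphic_def by blast

text \<open>Of the octahedron only this is kept: the cone \<open>q\<close> of the composite is an
  extension of \<open>v\<close> by \<open>z\<close>. It lets a truncation absorb one more filtration
  step.\<close>

lemma dtri_octahedral:
  assumes "dtri x y z f f1 f2" "dtri y w v g g1 g2"
  obtains q h1 h2 u t k where "dtri x w q (g \<cdot> f) h1 h2" "dtri z q v u t k"
proof -
  note H = dtri_Hom[OF assms(1)] and H' = dtri_Hom[OF assms(2)]
  obtain q h1 h2 where h: "dtri x w q (g \<cdot> f) h1 h2"
    using dtri_ex[OF Comp_closed[OF H(1) H'(1)]] .
  note K = dtri_Hom[OF h]
  have D: "Cod C f = Dom C g" "Cod C f1 = z" "Cod C h1 = q" "Cod C g1 = v"
    using H H' K by (auto simp: Hom_def)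
  obtain u t where "u \<in> Hom C z q" "t \<in> Hom C q v" "(u, t, ShA C f1 \<cdot> g2) \<in> Tri C"
    using Tri_octahedral[OF D(1), of f1 f2 g1 g2 h1 h2] assms h unfolding D dtri_def by metis
  then have "dtri z q v u t (ShA C f1 \<cdot> g2)"
    by (rule_tac Tri_dtriI)
  then show ?thesis
    using h that by blast
qed

end

section \<open>Coreflections and reflections into a class of objects\<close>

context additive_category
begin

text \<open>If \<open>x\<close> lies in \<open>W\<close>, this is the universal property of a
  coreflection of \<open>y\<close> into \<open>W\<close>; dually \<open>pre_bij\<close> describes a
  reflection of \<open>x\<close> when \<open>y\<close> lies in \<open>W\<close>. Stating it for
  arbitrary ends lets connecting maps be composed with truncation maps.\<close>

definition post_bij :: "'o set \<Rightarrow> 'm \<Rightarrow> 'o \<Rightarrow> 'o \<Rightarrow> bool" where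
  "post_bij W k x y \<longleftrightarrow> k \<in> Hom C x y \<and>
     (\<forall>w \<in> W. bij_betw (\<lambda>u. k \<cdot> u) (Hom C w x) (Hom C w y))"

definition pre_bij :: "'o set \<Rightarrow> 'm \<Rightarrow> 'o \<Rightarrow> 'o \<Rightarrow> bool" where
  "pre_bij W k x y \<longleftrightarrow> k \<in> Hom C x y \<and>
     (\<forall>w \<in> W. bij_betw (\<lambda>u. u \<cdot> k) (Hom C y w) (Hom C x w))"

lemma post_bijD:
  assumes "post_bij W k x y"
  shows "k \<in> Hom C x y" "w \<in> W \<Longrightarrow> bij_betw (\<lambda>u. k \<cdot> u) (Hom C w x) (Hom C w y)"
  using assms unfolding post_bij_def by simp_all

lemma pre_bijD:
  assumes "pre_bij W k x y"
  shows "k \<in> Hom C x y" "w \<in> W \<Longrightarrow> bij_betw (\<lambda>u. u \<cdot> k) (Hom C y w) (Hom C x w)"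
  using assms unfolding pre_bij_def by simp_all

lemma post_bij_surj:
  assumes "post_bij W k x y" "w \<in> W" "u \<in> Hom C w y"
  obtains v where "v \<in> Hom C w x" "u = k \<cdot> v"
  using bij_betw_imp_surj_on[OF post_bijD(2)[OF assms(1,2)]] assms(3) by (metis imageE)

lemma zero_kernel_inj:
  assumes k: "k \<in> Hom C x y"
    and inj: "\<And>u. \<lbrakk>u \<in> Hom C w x; k \<cdot> u = Zero C w y\<rbrakk> \<Longrightarrow> u = Zero C w x"
    and u: "u \<in> Hom C w x" and v: "v \<in> Hom C w x" and e: "k \<cdot> u = k \<cdot> v"
  shows "u = v"
proof -
  have "k \<cdot> Add C u (Neg C v) = Zero C w y"
    using Comp_Add_right[OF u Neg_closed[OF v] k] Comp_Neg[OF v k] e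
      Add_Neg[OF Comp_closed[OF v k]] by simp
  then have "Add C u (Neg C v) = Zero C w x"
    using inj[OF Add_closed[OF u Neg_closed[OF v]]] by simp
  then show ?thesis
    using Neg_unique[OF u Neg_closed[OF v]] Neg_Neg[OF u] Neg_Neg[OF v] by simp
qed

lemma post_bijI:
  assumes k: "k \<in> Hom C x y"
    and inj: "\<And>w u. \<lbrakk>w \<in> W; u \<in> Hom C w x; k \<cdot> u = Zero C w y\<rbrakk> \<Longrightarrow> u = Zero C w x"
    and surj: "\<And>w u. \<lbrakk>w \<in> W; u \<in> Hom C w y\<rbrakk> \<Longrightarrow> \<exists>v \<in> Hom C w x. u = k \<cdot> v"
  shows "post_bij W k x y"
proof -
  have "u = v" if w: "w \<in> W" and u: "u \<in> Hom C w x" and v: "v \<in> Hom C w x"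
    and e: "k \<cdot> u = k \<cdot> v" for w u v
    using zero_kernel_inj[OF k inj[OF w] u v e] .
  moreover have "(\<lambda>u. k \<cdot> u) ` Hom C w x = Hom C w y" if "w \<in> W" for w
    using surj[OF that] Comp_closed[OF _ k] by blast
  ultimately have "bij_betw (\<lambda>u. k \<cdot> u) (Hom C w x) (Hom C w y)" if "w \<in> W" for w
    unfolding bij_betw_def using that by (auto intro!: inj_onI)
  then show ?thesis
    using k unfolding post_bij_def by simp
qed

lemma pre_bij_surj:
  assumes "pre_bij W k x y" "w \<in> W" "u \<in> Hom C x w"
  obtains v where "v \<in> Hom C y w" "u = v \<cdot> k"
  using bij_betw_imp_surj_on[OF pre_bijD(2)[OF assms(1,2)]] assms(3) by (metis imageE)

lemma pre_bijI:
  assumes k: "k \<in> Hom C x y"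
    and inj: "\<And>w u. \<lbrakk>w \<in> W; u \<in> Hom C y w; u \<cdot> k = Zero C x w\<rbrakk> \<Longrightarrow> u = Zero C y w"
    and surj: "\<And>w u. \<lbrakk>w \<in> W; u \<in> Hom C x w\<rbrakk> \<Longrightarrow> \<exists>v \<in> Hom C y w. u = v \<cdot> k"
  shows "pre_bij W k x y"
proof -
  have "u = v" if w: "w \<in> W" and u: "u \<in> Hom C y w" and v: "v \<in> Hom C y w"
    and e: "u \<cdot> k = v \<cdot> k" for w u v
  proof -
    have "Add C u (Neg C v) \<cdot> k = Zero C x w"
      using Comp_Add_left[OF k u Neg_closed[OF v]] Neg_Comp[OF k v] e
        Add_Neg[OF Comp_closed[OF k v]] by simp
    then have "Add C u (Neg C v) = Zero C y w"
      using inj[OF w] Add_closed[OF u Neg_closed[OF v]] by simp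
    then show "u = v"
      using Neg_unique[OF u Neg_closed[OF v]] Neg_Neg[OF u] Neg_Neg[OF v] by simp
  qed
  moreover have "(\<lambda>u. u \<cdot> k) ` Hom C y w = Hom C x w" if "w \<in> W" for w
    using surj[OF that] Comp_closed[OF k] by blast
  ultimately have "bij_betw (\<lambda>u. u \<cdot> k) (Hom C y w) (Hom C x w)" if "w \<in> W" for w
    unfolding bij_betw_def using that by (auto intro!: inj_onI)
  then show ?thesis
    using k unfolding pre_bij_def by simp
qed

lemma post_bij_comp:
  assumes "post_bij W k x y" "post_bij W l y z"
  shows "post_bij W (l \<cdot> k) x z"
proof -
  have k: "k \<in> Hom C x y" and l: "l \<in> Hom C y z"
    using assms post_bijD(1) by simp_all
  have "bij_betw (\<lambda>u. (l \<cdot> k) \<cdot> u) (Hom C w x) (Hom C w z)" if "w \<in> W" for w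
  proof -
    have "bij_betw ((\<lambda>u. l \<cdot> u) \<circ> (\<lambda>u. k \<cdot> u)) (Hom C w x) (Hom C w z)"
      using bij_betw_trans[OF post_bijD(2)[OF assms(1) that] post_bijD(2)[OF assms(2) that]] .
    then show ?thesis
      by (rule bij_betw_cong[THEN iffD1, rotated]) (simp add: Comp_assoc[OF _ k l])
  qed
  then show ?thesis
    using Comp_closed[OF k l] unfolding post_bij_def by simp
qed

lemma pre_bij_comp:
  assumes "pre_bij W k x y" "pre_bij W l y z"
  shows "pre_bij W (l \<cdot> k) x z"
proof -
  have k: "k \<in> Hom C x y" and l: "l \<in> Hom C y z"
    using assms pre_bijD(1) by simp_all
  have "bij_betw (\<lambda>u. u \<cdot> (l \<cdot> k)) (Hom C z w) (Hom C x w)" if "w \<in> W" for w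
  proof -
    have "bij_betw ((\<lambda>u. u \<cdot> k) \<circ> (\<lambda>u. u \<cdot> l)) (Hom C z w) (Hom C x w)"
      using bij_betw_trans[OF pre_bijD(2)[OF assms(2) that] pre_bijD(2)[OF assms(1) that]] .
    then show ?thesis
      by (rule bij_betw_cong[THEN iffD1, rotated]) (simp add: Comp_assoc[OF k l])
  qed
  then show ?thesis
    using Comp_closed[OF k l] unfolding pre_bij_def by simp
qed

text \<open>Two coreflections of one object factor through each other, and uniqueness of
  factorizations makes both composites identities.\<close>

lemma post_bij_isomorphic:
  assumes s: "post_bij W s t x" and t: "t \<in> W" and s': "post_bij W s' t' x" and t': "t' \<in> W"
  shows "isomorphic C t t'"
proof -
  have S: "s \<in> Hom C t x" "s' \<in> Hom C t' x"
    by (rule post_bijD(1)[OF s], rule post_bijD(1)[OF s'])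
  have O: "t \<in> Ob C" "t' \<in> Ob C"
    using Hom_Ob(1)[OF S(1)] Hom_Ob(1)[OF S(2)] by simp_all
  have inj: "u = v" if "post_bij W k y x" "w \<in> W" "u \<in> Hom C w y" "v \<in> Hom C w y" "k \<cdot> u = k \<cdot> v"
    for k w y u v
    using inj_onD[OF bij_betw_imp_inj_on[OF post_bijD(2)[OF that(1,2)]] that(5,3,4)] .
  obtain u where u: "u \<in> Hom C t t'" "s = s' \<cdot> u"
    using post_bij_surj[OF s' t S(1)] .
  obtain v where v: "v \<in> Hom C t' t" "s' = s \<cdot> v"
    using post_bij_surj[OF s t' S(2)] .
  have "s \<cdot> (v \<cdot> u) = s \<cdot> Id C t"
    using Comp_assoc[OF u(1) v(1) S(1)] Comp_Id[OF S(1)] u(2) v(2) by metis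
  then have 1: "v \<cdot> u = Id C t"
    using inj[OF s t Comp_closed[OF u(1) v(1)] Id_closed[OF O(1)]] by blast
  have "s' \<cdot> (u \<cdot> v) = s' \<cdot> Id C t'"
    using Comp_assoc[OF v(1) u(1) S(2)] Comp_Id[OF S(2)] u(2) v(2) by metis
  then have 2: "u \<cdot> v = Id C t'"
    using inj[OF s' t' Comp_closed[OF v(1) u(1)] Id_closed[OF O(2)]] by blast
  show ?thesis
    using isomorphicI(2)[OF u(1) v(1) 1 2] .
qed

lemma pre_bij_isomorphic:
  assumes s: "pre_bij W s x t" and t: "t \<in> W" and s': "pre_bij W s' x t'" and t': "t' \<in> W"
  shows "isomorphic C t t'"
proof -
  have S: "s \<in> Hom C x t" "s' \<in> Hom C x t'"
    by (rule pre_bijD(1)[OF s], rule pre_bijD(1)[OF s'])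
  have O: "t \<in> Ob C" "t' \<in> Ob C"
    using Hom_Ob(2)[OF S(1)] Hom_Ob(2)[OF S(2)] by simp_all
  have inj: "u = v" if "pre_bij W k x y" "w \<in> W" "u \<in> Hom C y w" "v \<in> Hom C y w" "u \<cdot> k = v \<cdot> k"
    for k w y u v
    using inj_onD[OF bij_betw_imp_inj_on[OF pre_bijD(2)[OF that(1,2)]] that(5,3,4)] .
  obtain u where u: "u \<in> Hom C t t'" "s' = u \<cdot> s"
    using pre_bij_surj[OF s t' S(2)] .
  obtain v where v: "v \<in> Hom C t' t" "s = v \<cdot> s'"
    using pre_bij_surj[OF s' t S(1)] .
  have "(v \<cdot> u) \<cdot> s = Id C t \<cdot> s"
    using Comp_assoc[OF S(1) u(1) v(1)] Id_Comp[OF S(1)] u(2) v(2) by metis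
  then have 1: "v \<cdot> u = Id C t"
    using inj[OF s t Comp_closed[OF u(1) v(1)] Id_closed[OF O(1)]] by blast
  have "(u \<cdot> v) \<cdot> s' = Id C t' \<cdot> s'"
    using Comp_assoc[OF S(2) v(1) u(1)] Id_Comp[OF S(2)] u(2) v(2) by metis
  then have 2: "u \<cdot> v = Id C t'"
    using inj[OF s' t' Comp_closed[OF v(1) u(1)] Id_closed[OF O(2)]] by blast
  show ?thesis
    using isomorphicI(2)[OF u(1) v(1) 1 2] .
qed

end

section \<open>Additivity of the central charge on triangles\<close>

context triangulated_category
begin

lemma K_class_add:
  assumes Z: "Z \<in> hom (K_group C) complex_group" and d: "dtri x y z f g h"
  shows "Z (K_class C y) = Z (K_class C x) + Z (K_class C z)"
proof -
  let ?F = "free_Abelian_group (Ob C)"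
  let ?R = "{frag_of (Cod C f) - frag_of (Dom C f) - frag_of (Cod C g) | f g h. (f, g, h) \<in> Tri C}"
  interpret F: comm_group ?F
    by (rule abelian_free_Abelian_group)
  note H = dtri_Hom[OF d]
  have frag: "frag_of w \<in> carrier ?F" if "w \<in> Ob C" for w
    using that by simp
  have R: "?R \<subseteq> carrier ?F"
  proof
    fix r assume "r \<in> ?R"
    then obtain f g h where r: "r = frag_of (Cod C f) - frag_of (Dom C f) - frag_of (Cod C g)"
      "(f, g, h) \<in> Tri C" by blast
    have "dtri (Dom C f) (Cod C f) (Cod C g) f g h"
      using Tri_dtri r by blast
    then have "Dom C f \<in> Ob C" "Cod C f \<in> Ob C" "Cod C g \<in> Ob C"
      using dtri_Hom(4-6) by simp_all
    moreover have "Poly_Mapping.keys r \<subseteq> {Cod C f} \<union> {Dom C f} \<union> {Cod C g}"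
      unfolding r using keys_diff[of "frag_of (Cod C f) - frag_of (Dom C f)" "frag_of (Cod C g)"]
        keys_diff[of "frag_of (Cod C f)" "frag_of (Dom C f)"] by auto
    ultimately show "r \<in> carrier ?F"
      by auto
  qed
  have N: "K_relations C \<lhd> ?F"
    unfolding K_relations_def using F.generate_is_subgroup[OF R] F.subgroup_imp_normal by blast
  then have sub: "subgroup (K_relations C) ?F"
    by (rule normal_imp_subgroup)
  have c: "K_class C w \<in> carrier (K_group C)" if "w \<in> Ob C" for w
    unfolding K_group_def carrier_FactGroup K_class_def using frag[OF that] by blast
  have "frag_of y - frag_of x - frag_of z \<in> K_relations C"
  proof -
    have "Dom C f = x" "Cod C f = y" "Cod C g = z"
      using H by (auto simp: Hom_def)
    then show ?thesis
      unfolding K_relations_def using d by (auto simp: dtri_def intro!: generate.incl)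
  qed
  \<comment> \<open>The relation of the triangle puts \<open>frag_of y\<close> into the coset of
    \<open>frag_of x + frag_of z\<close>, so the two elements have the same coset.\<close>
  moreover have "frag_of y = (frag_of y - frag_of x - frag_of z) \<otimes>\<^bsub>?F\<^esub> (frag_of x + frag_of z)"
    by simp
  ultimately have "frag_of y \<in> K_relations C #>\<^bsub>?F\<^esub> (frag_of x + frag_of z)"
    unfolding r_coset_def by blast
  moreover have xz: "frag_of x + frag_of z \<in> carrier ?F"
    using F.m_closed[OF frag frag, of x z] H by simp
  ultimately have "K_class C y = K_relations C #>\<^bsub>?F\<^esub> (frag_of x + frag_of z)"
    unfolding K_class_def using F.repr_independence[OF _ xz sub] by simp
  also have "\<dots> = K_class C x \<otimes>\<^bsub>K_group C\<^esub> K_class C z"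
    using normal.rcos_sum[OF N frag frag, of x z] H unfolding K_group_def K_class_def by simp
  finally have "Z (K_class C y) = Z (K_class C x) \<otimes>\<^bsub>complex_group\<^esub> Z (K_class C z)"
    using hom_mult[OF Z c c] H by simp
  then show ?thesis
    by (simp add: complex_group_def)
qed

end

section \<open>Truncations and Harder--Narasimhan filtrations\<close>

text \<open>The charge is a function on objects that is additive on triangles; the Grothendieck
  group enters only when the locale is instantiated.\<close>

locale central_charge_slicing = triangulated_category C
  for C :: "('o, 'm, 'e) tricat_scheme" (structure) +
  fixes P :: "real \<Rightarrow> 'o set" and Z :: "'o \<Rightarrow> complex"
  assumes slicing: "slicing C P"
    and Z_add: "dtri x y z f g h \<Longrightarrow> Z y = Z x + Z z"
    and Z_ray: "\<lbrakk>a \<in> P \<phi>; \<not> zero_object C a\<rbrakk>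
      \<Longrightarrow> \<exists>r > 0. Z a = of_real r * exp (\<i> * of_real pi * of_real \<phi>)"
begin

lemma Z_zero:
  assumes z: "zero_object C z"
  shows "Z z = 0"
proof -
  have "z \<in> Ob C"
    using z zero_object_iff by blast
  then have "Z z = Z z + Z z"
    using Z_add[OF dtri_Id] z by blast
  then show ?thesis
    by simp
qed

lemma Z_isomorphic:
  assumes "isomorphic C x y"
  shows "Z x = Z y"
proof -
  obtain f where f: "f \<in> Hom C x y" "isomorphism C f"
    using assms unfolding isomorphic_def by blast
  obtain z g h where d: "dtri x y z f g h"
    using dtri_ex f by blast
  then show ?thesis
    using Z_add[OF d] Z_zero dtri_iso_zero[OF d] f by simp
qed

lemma Z_ShO: "x \<in> Ob C \<Longrightarrow> Z (ShO C x) = - Z x"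
proof -
  assume x: "x \<in> Ob C"
  obtain e where e: "zero_object C e"
    using ex_zero_object by blast
  show ?thesis
    using Z_add[OF dtri_rotate[OF dtri_Id[OF x e]]] Z_zero[OF e] by (simp add: add_eq_0_iff)
qed

lemma P_Ob: "x \<in> P \<phi> \<Longrightarrow> x \<in> Ob C"
  using slicing unfolding slicing_def by blast

lemma P_isomorphic: "\<lbrakk>x \<in> P \<phi>; isomorphic C x y\<rbrakk> \<Longrightarrow> y \<in> P \<phi>"
proof -
  assume x: "x \<in> P \<phi>" "isomorphic C x y"
  then have "y \<in> Ob C"
    using Hom_Ob(2) unfolding isomorphic_def by blast
  moreover have "\<forall>x \<in> P \<phi>. \<forall>y \<in> Ob C. isomorphic C x y \<longrightarrow> y \<in> P \<phi>"
    using slicing unfolding slicing_def by simp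
  ultimately show ?thesis
    using x by simp
qed

lemma P_Hom: "\<lbrakk>\<phi> > \<psi>; x \<in> P \<phi>; y \<in> P \<psi>; f \<in> Hom C x y\<rbrakk> \<Longrightarrow> f = Zero C x y"
  using slicing unfolding slicing_def by blast

lemma P_ShO: "x \<in> P \<phi> \<Longrightarrow> ShO C x \<in> P (\<phi> + 1)"
  using slicing isomorphic_refl ShO_closed P_Ob unfolding slicing_def by blast

lemma P_unshift: "y \<in> P (\<phi> + 1) \<Longrightarrow> \<exists>x \<in> P \<phi>. isomorphic C (ShO C x) y"
  using slicing unfolding slicing_def by blast

lemma Hom_full_subcat: "x \<in> S \<Longrightarrow> y \<in> S \<Longrightarrow> Hom (full_subcat C S) x y = Hom C x y"
  by (auto simp: Hom_def full_subcat_def)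

text \<open>A zero object of the subcategory has a single endomorphism, so its identity is the zero
  map, and this makes it zero in all of \<open>C\<close>.\<close>

lemma zero_object_full_subcat:
  "zero_object (full_subcat C (P \<phi>)) z \<longleftrightarrow> z \<in> P \<phi> \<and> zero_object C z"
proof -
  have Ob: "Ob (full_subcat C (P \<phi>)) = P \<phi>"
    by (simp add: full_subcat_def)
  show ?thesis
  proof
    assume z: "zero_object (full_subcat C (P \<phi>)) z"
    then have zP: "z \<in> P \<phi>"
      unfolding zero_object_def Ob by simp
    then have "\<exists>!f. f \<in> Hom C z z"
      using z Hom_full_subcat[OF zP zP] Ob unfolding zero_object_def by metis
    then show "z \<in> P \<phi> \<and> zero_object C z"
      using zP zero_object_iff P_Ob Id_closed Zero_closed by metis
  next
    assume z: "z \<in> P \<phi> \<and> zero_object C z"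
    then have "(\<exists>!f. f \<in> Hom C z x) \<and> (\<exists>!f. f \<in> Hom C x z)" if "x \<in> P \<phi>" for x
      using P_Ob[OF that] unfolding zero_object_def by simp
    then show "zero_object (full_subcat C (P \<phi>)) z"
      unfolding zero_object_def[of "full_subcat C (P \<phi>)"] Ob using z Hom_full_subcat by simp
  qed
qed

text \<open>Additivity of \<open>P \<phi>\<close> provides one zero object; all others are
  isomorphic to it.\<close>

lemma P_zero: "zero_object C z \<Longrightarrow> z \<in> P \<phi>"
proof -
  assume z: "zero_object C z"
  have "additive_category (full_subcat C (P \<phi>))"
    using slicing unfolding slicing_def by blast
  then obtain e where "e \<in> P \<phi>" "zero_object C e"
    using additive_category.ex_zero_object zero_object_full_subcat by blast
  moreover have "isomorphic C e z"
  proof -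
    have O: "e \<in> Ob C" "z \<in> Ob C" "Id C e = Zero C e e" "Id C z = Zero C z z"
      using calculation z zero_object_iff by auto
    note c = Zero_closed[OF O(1,2)] Zero_closed[OF O(2,1)]
    show ?thesis
      using isomorphicI(2)[OF c] Zero_factor[OF z c] Zero_factor[OF calculation(2) c(2,1)] O by simp
  qed
  ultimately show ?thesis
    using P_isomorphic by blast
qed

text \<open>Bridgeland's \<open>P(U)\<close>.\<close>

definition cl :: "real set \<Rightarrow> 'o set" where
  "cl U = extension_closure C (\<Union>\<phi>\<in>U. P \<phi>)"

lemma cl_base: "x \<in> P \<phi> \<Longrightarrow> \<phi> \<in> U \<Longrightarrow> x \<in> cl U"
  unfolding cl_def by (auto intro: extension_closure.base)

lemma cl_dtri:
  assumes "dtri x y z f g h" "x \<in> cl U" "z \<in> cl U"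
  shows "y \<in> cl U"
proof -
  have "Dom C f = x" "Cod C f = y" "Cod C g = z"
    using dtri_Hom[OF assms(1)] by (auto simp: Hom_def)
  then show ?thesis
    using assms extension_closure.extension[of f g h C] unfolding cl_def dtri_def by metis
qed

lemma cl_induct [consumes 1, case_names base dtri]:
  assumes "x \<in> cl U"
    and base: "\<And>x \<phi>. \<lbrakk>\<phi> \<in> U; x \<in> P \<phi>\<rbrakk> \<Longrightarrow> Q x"
    and dtri: "\<And>x y z f g h. \<lbrakk>dtri x y z f g h; Q x; Q z\<rbrakk> \<Longrightarrow> Q y"
  shows "Q x"
  using assms(1) unfolding cl_def
proof (induction rule: extension_closure.induct)
  case (extension f g h)
  then show ?case
    using dtri[OF Tri_dtri] by blast
qed (use base in blast)

lemma cl_Ob: "x \<in> cl U \<Longrightarrow> x \<in> Ob C"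
  by (induction rule: cl_induct) (blast dest: P_Ob dtri_Hom(5))+

lemma cl_zero: "\<lbrakk>zero_object C z; U \<noteq> {}\<rbrakk> \<Longrightarrow> z \<in> cl U"
  using P_zero cl_base by blast

lemma cl_mono:
  assumes "x \<in> cl U" "U \<subseteq> V"
  shows "x \<in> cl V"
  using assms(1)
proof (induction rule: cl_induct)
  case (base \<phi> x)
  then show ?case
    using cl_base assms(2) by blast
qed (rule cl_dtri)

lemma cl_ShO:
  assumes "x \<in> cl U"
  shows "ShO C x \<in> cl ((\<lambda>\<phi>. \<phi> + 1) ` U)"
  using assms
proof (induction rule: cl_induct)
  case (base \<phi> x)
  then show ?case
    using cl_base[OF P_ShO] by simp
next
  case (dtri x y z f g h)
  then show ?case
    using cl_dtri[OF dtri_shift] by blast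
qed

text \<open>Vanishing of Hom passes through extensions by exactness: first in the target, where a
  map that dies in the quotient lifts to the subobject, then dually in the source.\<close>

lemma cl_Hom:
  assumes "x \<in> cl U" "y \<in> cl V" "\<And>a b. a \<in> U \<Longrightarrow> b \<in> V \<Longrightarrow> a > b" "f \<in> Hom C x y"
  shows "f = Zero C x y"
proof -
  have P: "f = Zero C x y" if x: "x \<in> P a" "a \<in> U" and f: "f \<in> Hom C x y" for x a f
    using \<open>y \<in> cl V\<close> f
  proof (induction arbitrary: f rule: cl_induct)
    case (base b y)
    then show ?case
      using P_Hom[OF assms(3)] x by blast
  next
    case (dtri y0 y y1 g h k)
    note H = dtri_Hom[OF dtri(1)]
    have "h \<cdot> f = Zero C x y1"
      using dtri Comp_closed H by blast
    then obtain v where "v \<in> Hom C x y0" "f = g \<cdot> v"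
      using dtri_lift[OF dtri(1)] dtri by metis
    then show ?case
      using dtri Comp_Zero[OF H(1)] P_Ob x by metis
  qed
  show ?thesis
    using assms(1,4)
  proof (induction arbitrary: f rule: cl_induct)
    case (dtri x0 x x1 g h k)
    note H = dtri_Hom[OF dtri(1)]
    have "f \<cdot> g = Zero C x0 y"
      using dtri Comp_closed H by blast
    then obtain v where "v \<in> Hom C x1 y" "f = v \<cdot> h"
      using dtri_extend[OF dtri(1)] dtri by metis
    then show ?case
      using dtri Zero_Comp[OF H(2)] Hom_Ob by metis
  qed (use P in blast)
qed

text \<open>Cuts treat the half-lines \<open>{c..}\<close> and \<open>{c<..}\<close> at once.
  Excluding the two trivial sets puts the zero objects into both \<open>cl U\<close> and
  \<open>cl (- U)\<close>.\<close>

definition cut :: "real set \<Rightarrow> bool" where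
  "cut U \<longleftrightarrow> U \<noteq> {} \<and> U \<noteq> UNIV \<and> (\<forall>a b. a \<in> U \<and> a \<le> b \<longrightarrow> b \<in> U)"

lemma cut_atLeast: "cut {c..}" and cut_greaterThan: "cut {c<..}"
proof -
  have "c \<in> {c..}" "c - 1 \<notin> {c..}" "c + 1 \<in> {c<..}" "c \<notin> {c<..}"
    by auto
  then show "cut {c..}" "cut {c<..}"
    unfolding cut_def by (fastforce)+
qed

lemma cut_less: "\<lbrakk>cut U; a \<in> U; b \<in> - U\<rbrakk> \<Longrightarrow> a > b"
  unfolding cut_def by (metis ComplD linorder_not_less)

lemma cl_ShO_cut: "\<lbrakk>cut U; x \<in> cl U\<rbrakk> \<Longrightarrow> ShO C x \<in> cl U"
proof -
  assume U: "cut U" "x \<in> cl U"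
  have "(\<lambda>\<phi>. \<phi> + 1) ` U \<subseteq> U"
  proof
    fix b assume "b \<in> (\<lambda>\<phi>. \<phi> + 1) ` U"
    then obtain a where "a \<in> U" "a \<le> b"
      by auto
    then show "b \<in> U"
      using U unfolding cut_def by blast
  qed
  then show ?thesis
    using cl_ShO[OF U(2)] cl_mono by blast
qed

text \<open>For a cut \<open>U\<close> this is the truncation triangle of the t-structure with aisle
  \<open>cl U\<close>.\<close>

definition truncation :: "real set \<Rightarrow> 'o \<Rightarrow> 'o \<Rightarrow> 'o \<Rightarrow> bool" where
  "truncation U x t y \<longleftrightarrow> t \<in> cl U \<and> y \<in> cl (- U) \<and> (\<exists>s p r. dtri t x y s p r)"

text \<open>Maps from \<open>cl U\<close> to \<open>y\<close> vanish, so every map from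
  \<open>cl U\<close> to \<open>x\<close> lifts to \<open>t\<close>. The lift is unique because
  \<open>cl U\<close> is stable under the shift, so that maps from \<open>ShO C w\<close> to
  \<open>y\<close> vanish too.\<close>

lemma truncation_post_bij:
  assumes U: "cut U" and d: "dtri t x y s p r" and t: "t \<in> cl U" and y: "y \<in> cl (- U)"
  shows "post_bij (cl U) s t x"
proof (rule post_bijI)
  note H = dtri_Hom[OF d]
  show "s \<in> Hom C t x" by (fact H)
  show "\<exists>v \<in> Hom C w t. u = s \<cdot> v" if w: "w \<in> cl U" and u: "u \<in> Hom C w x" for w u
  proof -
    have "p \<cdot> u = Zero C w y"
      using cl_Hom[OF w y cut_less[OF U] Comp_closed[OF u H(2)]] .
    then show ?thesis
      using dtri_lift[OF d u] by metis
  qed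
  show "u = Zero C w t" if w: "w \<in> cl U" and u: "u \<in> Hom C w t" "s \<cdot> u = Zero C w x" for w u
  proof -
    \<comment> \<open>The kernel of composition with \<open>s\<close> is controlled by the map
      before \<open>s\<close> in the long sequence, which becomes \<open>r\<close> after one
      shift.\<close>
    have "ShA C s \<cdot> ShA C u = Zero C (ShO C w) (ShO C x)"
      using ShA_Comp[OF u(1) H(1)] u ShA_Zero Hom_Ob H by metis
    then obtain v where v: "v \<in> Hom C (ShO C w) y" "ShA C u = r \<cdot> v"
      using dtri_lift2[OF d ShA_closed[OF u(1)]] by metis
    have "v = Zero C (ShO C w) y"
      using cl_Hom[OF cl_ShO_cut[OF U w] y cut_less[OF U] v(1)] .
    then have "ShA C u = Zero C (ShO C w) (ShO C t)"
      using v Comp_Zero[OF H(3)] Hom_Ob by metis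
    then show ?thesis
      using ShA_eq_Zero u by metis
  qed
qed

lemma truncation_pre_bij:
  assumes U: "cut U" and d: "dtri t x y s p r" and t: "t \<in> cl U" and y: "y \<in> cl (- U)"
  shows "pre_bij (cl (- U)) p x y"
proof (rule pre_bijI)
  note H = dtri_Hom[OF d]
  show "p \<in> Hom C x y" by (fact H)
  show "\<exists>v \<in> Hom C y w. u = v \<cdot> p" if w: "w \<in> cl (- U)" and u: "u \<in> Hom C x w" for w u
  proof -
    have "u \<cdot> s = Zero C t w"
      using cl_Hom[OF t w cut_less[OF U] Comp_closed[OF H(1) u]] .
    then show ?thesis
      using dtri_extend[OF d u] by metis
  qed
  show "u = Zero C y w" if w: "w \<in> cl (- U)" and u: "u \<in> Hom C y w" "u \<cdot> p = Zero C x w" for w u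
  proof -
    obtain v where v: "v \<in> Hom C (ShO C t) w" "u = v \<cdot> r"
      using dtri_extend[OF dtri_rotate[OF d] u] .
    have "v = Zero C (ShO C t) w"
      using cl_Hom[OF cl_ShO_cut[OF U t] w cut_less[OF U] v(1)] .
    then show ?thesis
      using v Zero_Comp[OF H(3)] Hom_Ob by metis
  qed
qed

text \<open>The upper parts are coreflections of the same object, hence isomorphic; the charges of
  the lower parts are then equal by subtraction.\<close>

lemma truncation_unique:
  assumes "cut U" "truncation U x t y" "truncation U x t' y'"
  shows "Z t = Z t'" "Z y = Z y'"
proof -
  show 1: "Z t = Z t'"
    using assms truncation_post_bij post_bij_isomorphic Z_isomorphic
    unfolding truncation_def by metis
  then show "Z y = Z y'"
    using assms Z_add unfolding truncation_def by (metis add_left_cancel)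
qed

lemma truncation_ShO:
  assumes "truncation U x t y"
  shows "truncation ((\<lambda>\<phi>. \<phi> + 1) ` U) (ShO C x) (ShO C t) (ShO C y)"
proof -
  have "bij (\<lambda>\<phi>::real. \<phi> + 1)"
    by (rule bijI') (auto intro: exI[of _ "_ - 1"])
  then have "- ((\<lambda>\<phi>. \<phi> + 1) ` U) = (\<lambda>\<phi>. \<phi> + 1) ` (- U)"
    by (simp add: bij_image_Compl_eq)
  then show ?thesis
    using assms cl_ShO dtri_shift unfolding truncation_def by metis
qed

lemma truncation_upper:
  assumes "x \<in> cl U" "cut U" "zero_object C e"
  shows "truncation U x x e"
proof -
  have "- U \<noteq> {}"
    using assms unfolding cut_def by auto
  then show ?thesis
    using assms(1) cl_zero[OF assms(3)] dtri_Id[OF cl_Ob[OF assms(1)] assms(3)]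
    unfolding truncation_def by metis
qed

lemma truncation_lower:
  assumes "x \<in> cl (- U)" "cut U" "zero_object C e"
  shows "truncation U x e x"
proof -
  have "U \<noteq> {}"
    using assms unfolding cut_def by auto
  then show ?thesis
    using assms(1) cl_zero[OF assms(3)] dtri_zero_Id[OF cl_Ob[OF assms(1)] assms(3)]
    unfolding truncation_def by metis
qed

section \<open>Harder--Narasimhan factors and their uniqueness\<close>

lemma HN_ex: "x \<in> Ob C \<Longrightarrow> \<exists>n E \<phi> A. HN_filtration C P x n E \<phi> A"
proof (cases "zero_object C x")
  case True
  then have "HN_filtration C P x 0 (\<lambda>_. x) (\<lambda>_. 0) (\<lambda>_. x)"
    unfolding HN_filtration_def by simp
  then show ?thesis by blast
qed (use slicing in \<open>auto simp: slicing_def\<close>)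

lemma HN_Suc:
  assumes "HN_filtration C P x (Suc n) E \<phi> A"
  shows "HN_filtration C P (E n) n E \<phi> A" "\<exists>f g h. dtri (E n) x (A n) f g h"
    "A n \<in> P (\<phi> n)" "\<not> zero_object C (A n)"
proof -
  show "HN_filtration C P (E n) n E \<phi> A"
    using assms unfolding HN_filtration_def by auto
  have "E (Suc n) = x" "\<exists>f g h. (f, g, h) \<in> Tri C \<and>
           f \<in> Hom C (E n) (E (Suc n)) \<and> g \<in> Hom C (E (Suc n)) (A n)"
    using assms unfolding HN_filtration_def by auto
  then show "\<exists>f g h. dtri (E n) x (A n) f g h"
    using Tri_dtriI by metis
  show "A n \<in> P (\<phi> n)" "\<not> zero_object C (A n)"
    using assms unfolding HN_filtration_def by auto
qed

lemma HN_factor: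
  assumes "HN_filtration C P x n E \<phi> A" "j < n"
  shows "A j \<in> P (\<phi> j)" "\<not> zero_object C (A j)"
  using assms unfolding HN_filtration_def by auto

lemma HN_phase_less: "\<lbrakk>HN_filtration C P x n E \<phi> A; i < j; j < n\<rbrakk> \<Longrightarrow> \<phi> j < \<phi> i"
  unfolding HN_filtration_def by auto

lemma HN_inj:
  assumes "HN_filtration C P x n E \<phi> A"
  shows "inj_on \<phi> {..<n}"
  by (rule linorder_inj_onI') (use HN_phase_less[OF assms] in fastforce)

lemma HN_zero: "HN_filtration C P x 0 E \<phi> A \<Longrightarrow> zero_object C x"
  unfolding HN_filtration_def by auto

lemma HN_Z: "HN_filtration C P x n E \<phi> A \<Longrightarrow> Z x = (\<Sum>j<n. Z (A j))"
proof (induction n arbitrary: x)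
  case 0
  then show ?case
    using HN_zero Z_zero by simp
next
  case (Suc n)
  then show ?case
    using HN_Suc[OF Suc.prems] Z_add by fastforce
qed

lemma HN_cl:
  assumes "HN_filtration C P x n E \<phi> A" "\<And>j. j < n \<Longrightarrow> \<phi> j \<in> U" "U \<noteq> {}"
  shows "x \<in> cl U"
  using assms(1,2)
proof (induction n arbitrary: x)
  case 0
  then show ?case
    using HN_zero cl_zero assms(3) by blast
next
  case (Suc n)
  have "E n \<in> cl U"
    using Suc.IH[OF HN_Suc(1)[OF Suc.prems(1)]] Suc.prems(2) by simp
  moreover have "A n \<in> cl U"
    using cl_base[OF HN_Suc(3)[OF Suc.prems(1)]] Suc.prems(2) by simp
  ultimately show ?case
    using HN_Suc(2)[OF Suc.prems(1)] cl_dtri by blast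
qed

text \<open>Phases decrease, so if the last one lies in \<open>U\<close>, all do and
  \<open>x\<close> is its own upper part. Otherwise the last factor belongs to the lower part, and
  the upper part is that of \<open>E n\<close>.\<close>

lemma HN_truncation:
  assumes "HN_filtration C P x n E \<phi> A" "cut U"
  shows "\<exists>t y. truncation U x t y \<and> Z t = (\<Sum>j<n. if \<phi> j \<in> U then Z (A j) else 0)"
  using assms(1)
proof (induction n arbitrary: x)
  case 0
  then have x: "zero_object C x"
    by (rule HN_zero)
  moreover have "- U \<noteq> {}"
    using assms(2) unfolding cut_def by blast
  ultimately show ?case
    using truncation_lower[OF cl_zero assms(2)] Z_zero[OF x] by (intro exI[of _ x]) simp
next
  case (Suc n)
  show ?case
  proof (cases "\<phi> n \<in> U")
    case True
    have U: "\<phi> j \<in> U" if "j < Suc n" for j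
    proof (cases "j = n")
      case False
      then have "\<phi> n \<le> \<phi> j"
        using that HN_phase_less[OF Suc.prems, of j n] by simp
      then show ?thesis
        using True assms(2) unfolding cut_def by blast
    qed (use True in simp)
    obtain e where e: "zero_object C e"
      using ex_zero_object by blast
    have "U \<noteq> {}"
      using True by blast
    then have "truncation U x x e"
      using truncation_upper[OF HN_cl[OF Suc.prems U] assms(2) e] by simp
    moreover have "Z x = (\<Sum>j<Suc n. if \<phi> j \<in> U then Z (A j) else 0)"
      unfolding HN_Z[OF Suc.prems] using U by (intro sum.cong) auto
    ultimately show ?thesis
      by blast
  next
    case False
    obtain t y where ty: "truncation U (E n) t y"
      "Z t = (\<Sum>j<n. if \<phi> j \<in> U then Z (A j) else 0)"
      using Suc.IH[OF HN_Suc(1)[OF Suc.prems]] by blast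
    then obtain s p r where d: "dtri t (E n) y s p r"
      unfolding truncation_def by blast
    obtain f g h where d': "dtri (E n) x (A n) f g h"
      using HN_Suc(2)[OF Suc.prems] by blast
    \<comment> \<open>Octahedron on \<open>t -> E n -> x\<close>: the new lower part
      \<open>y'\<close> is an extension of \<open>A n\<close> by the old one, so it stays in
      \<open>cl (- U)\<close>.\<close>
    obtain y' p' r' u v k where dd: "dtri t x y' (f \<cdot> s) p' r'" "dtri y y' (A n) u v k"
      using dtri_octahedral[OF d d'] .
    have "A n \<in> cl (- U)"
      using HN_Suc(3)[OF Suc.prems] False cl_base by blast
    then have "truncation U x t y'"
      using ty dd cl_dtri unfolding truncation_def by blast
    then show ?thesis
      using ty False by auto
  qed
qed

lemma HN_truncation_Z:
  assumes "HN_filtration C P x n E \<phi> A" "cut U" "truncation U x t y"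
  shows "Z t = (\<Sum>j<n. if \<phi> j \<in> U then Z (A j) else 0)"
  using HN_truncation[OF assms(1,2)] truncation_unique assms(2,3) by metis

text \<open>Truncating at \<open>\<ge> c\<close> and at \<open>> c\<close> isolates the charge of
  phase \<open>c\<close>. The right-hand side does not involve the filtration, whence
  \<open>HN_jump_unique\<close>.\<close>

lemma HN_jump:
  assumes "HN_filtration C P x n E \<phi> A" "truncation {c..} x t y" "truncation {c<..} x t' y'"
  shows "(\<Sum>j<n. if \<phi> j = c then Z (A j) else 0) = Z t - Z t'"
  unfolding HN_truncation_Z[OF assms(1) cut_atLeast assms(2)]
    HN_truncation_Z[OF assms(1) cut_greaterThan assms(3)] sum_subtractf[symmetric]
  by (rule sum.cong) auto

lemma HN_jump_unique:
  assumes "HN_filtration C P x n E \<phi> A" "HN_filtration C P x n' E' \<phi>' A'"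
  shows "(\<Sum>j<n. if \<phi> j = c then Z (A j) else 0) = (\<Sum>j<n'. if \<phi>' j = c then Z (A' j) else 0)"
proof -
  obtain t y t' y' where "truncation {c..} x t y" "truncation {c<..} x t' y'"
    using HN_truncation[OF assms(1) cut_atLeast] HN_truncation[OF assms(1) cut_greaterThan] by blast
  then show ?thesis
    using HN_jump[OF assms(1)] HN_jump[OF assms(2)] by simp
qed

lemma HN_sum_at_phase:
  assumes "HN_filtration C P x n E \<phi> A" "i < n"
  shows "(\<Sum>j<n. if \<phi> j = \<phi> i then Z (A j) else 0) = Z (A i)"
proof -
  have "(\<Sum>j<n. if \<phi> j = \<phi> i then Z (A j) else 0) = (\<Sum>j<n. if j = i then Z (A j) else 0)"
    using HN_inj[OF assms(1)] assms(2) by (intro sum.cong) (auto simp: inj_on_def)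
  then show ?thesis
    using assms(2) by simp
qed

lemma Z_nonzero: "\<lbrakk>a \<in> P \<phi>; \<not> zero_object C a\<rbrakk> \<Longrightarrow> Z a \<noteq> 0"
  using Z_ray by fastforce

text \<open>If \<open>V\<close> lay strictly on one side of \<open>\<phi> i\<close>, the closed and
  the open cut at \<open>\<phi> i\<close> would truncate \<open>x\<close> in the same trivial way,
  so the jump there would be zero. But it is the charge of the nonzero semistable object
  \<open>A i\<close>.\<close>

lemma HN_phase_in:
  assumes x: "x \<in> cl V" and HN: "HN_filtration C P x n E \<phi> A" "i < n"
  shows "\<exists>a \<in> V. a \<le> \<phi> i" "\<exists>b \<in> V. \<phi> i \<le> b"
proof -
  obtain e where e: "zero_object C e"
    using ex_zero_object by blast
  note nz = Z_nonzero[OF HN_factor[OF HN]]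
  show "\<exists>a \<in> V. a \<le> \<phi> i"
  proof (rule ccontr)
    assume "\<not> ?thesis"
    then have "V \<subseteq> {\<phi> i..}" "V \<subseteq> {\<phi> i<..}"
      by auto
    then have "truncation {\<phi> i..} x x e" "truncation {\<phi> i<..} x x e"
      using truncation_upper cut_atLeast cut_greaterThan cl_mono x e by metis+
    then show False
      using HN_jump[OF HN(1)] HN_sum_at_phase[OF HN] nz by simp
  qed
  show "\<exists>b \<in> V. \<phi> i \<le> b"
  proof (rule ccontr)
    assume "\<not> ?thesis"
    then have "V \<subseteq> - {\<phi> i..}" "V \<subseteq> - {\<phi> i<..}"
      by auto
    then have "truncation {\<phi> i..} x e x" "truncation {\<phi> i<..} x e x"
      using truncation_lower cut_atLeast cut_greaterThan cl_mono x e by metis+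
    then show False
      using HN_jump[OF HN(1)] HN_sum_at_phase[OF HN] nz by simp
  qed
qed

text \<open>Regrouped by phase over the union of both phase sets, each sum depends only on the total
  charge in each phase, which is independent of the filtration. Foreign phases contribute
  zero.\<close>

lemma HN_sum_unique:
  assumes HN: "HN_filtration C P x n E \<phi> A" and HN': "HN_filtration C P x n' E' \<phi>' A'"
  shows "(\<Sum>j<n. w (\<phi> j) * cmod (Z (A j))) = (\<Sum>j<n'. w (\<phi>' j) * cmod (Z (A' j)))"
proof -
  define S where "S = \<phi> ` {..<n} \<union> \<phi>' ` {..<n'}"
  have S: "finite S"
    unfolding S_def by simp
  have *: "(\<Sum>j<m. w (\<psi> j) * cmod (Z (B j))) =
      (\<Sum>c\<in>S. w c * cmod (\<Sum>j<m. if \<psi> j = c then Z (B j) else 0))"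
    if H: "HN_filtration C P x m F \<psi> B" and sub: "\<psi> ` {..<m} \<subseteq> S" for m F \<psi> B
  proof -
    have "(\<Sum>j<m. if \<psi> j = c then Z (B j) else 0) = 0" if "c \<in> S - \<psi> ` {..<m}" for c
      using that by (intro sum.neutral) auto
    then have "(\<Sum>c\<in>S. w c * cmod (\<Sum>j<m. if \<psi> j = c then Z (B j) else 0)) =
        (\<Sum>c\<in>\<psi> ` {..<m}. w c * cmod (\<Sum>j<m. if \<psi> j = c then Z (B j) else 0))"
      by (intro sum.mono_neutral_right S sub) auto
    also have "\<dots> = (\<Sum>i<m. w (\<psi> i) * cmod (\<Sum>j<m. if \<psi> j = \<psi> i then Z (B j) else 0))"
      by (simp add: sum.reindex[OF HN_inj[OF H]])
    also have "\<dots> = (\<Sum>j<m. w (\<psi> j) * cmod (Z (B j)))"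
      by (intro sum.cong refl) (simp add: HN_sum_at_phase[OF H])
    finally show ?thesis
      by simp
  qed
  show ?thesis
    using *[OF HN] *[OF HN'] HN_jump_unique[OF HN HN'] S_def by simp
qed

end

section \<open>The support functional and the mass inequality\<close>

text \<open>The quotient \<open>h\<close> of the two sides has derivative of sign opposite to
  \<open>sin x\<close>, so on \<open>[-pi, pi]\<close> it attains its value 1 at 0 as a strict
  maximum. The mean value theorem is applied on each side of 0.\<close>

lemma cos_sin_less_exp:
  fixes s \<delta> :: real
  assumes "\<bar>\<delta>\<bar> \<le> pi" "\<delta> \<noteq> 0"
  shows "cos \<delta> + s * sin \<delta> < exp (s * \<delta>)"
proof -
  define h where "h = (\<lambda>x::real. exp (- s * x) * (cos x + s * sin x))"
  define h' where "h' = (\<lambda>x::real. - (1 + s\<^sup>2) * sin x * exp (- s * x))"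
  have D: "(h has_real_derivative h' x) (at x)" for x
    unfolding h_def h'_def
    by (auto intro!: derivative_eq_intros simp: algebra_simps power2_eq_square)
  have pos: "0 < (1 + s\<^sup>2) * exp (- s * x)" for x
    by (intro mult_pos_pos add_pos_nonneg) auto
  have h0: "h 0 = 1"
    unfolding h_def by simp
  have "h \<delta> < 1"
  proof (cases "\<delta> > 0")
    case True
    then obtain z where z: "0 < z" "z < \<delta>" "h \<delta> - h 0 = (\<delta> - 0) * h' z"
      using MVT2[of 0 \<delta> h h'] D by blast
    then have "0 < sin z"
      using assms by (intro sin_gt_zero) auto
    then have "0 < (\<delta> * sin z) * ((1 + s\<^sup>2) * exp (- s * z))"
      using True by (intro mult_pos_pos[OF _ pos] mult_pos_pos)
    then show ?thesis
      using z h0 unfolding h'_def by (simp add: algebra_simps)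
  next
    case False
    then obtain z where z: "\<delta> < z" "z < 0" "h 0 - h \<delta> = (0 - \<delta>) * h' z"
      using MVT2[of \<delta> 0 h h'] D assms(2) by fastforce
    then have "0 < sin (- z)"
      using assms by (intro sin_gt_zero) auto
    then have "0 < (- \<delta> * sin (- z)) * ((1 + s\<^sup>2) * exp (- s * z))"
      using False assms(2) by (intro mult_pos_pos[OF _ pos] mult_pos_pos) auto
    then show ?thesis
      using z h0 unfolding h'_def by (simp add: algebra_simps)
  qed
  then have "exp (s * \<delta>) * h \<delta> < exp (s * \<delta>)"
    by simp
  moreover have "exp (s * \<delta>) * h \<delta> = cos \<delta> + s * sin \<delta>"
    unfolding h_def by (simp add: mult.assoc[symmetric] exp_add[symmetric])
  ultimately show ?thesis
    by simp
qed

text \<open>The differential of \<open>r e\<^sup>i\<^sup>\<pi>\<^sup>\<psi> \<mapsto> q\<^sup>\<psi> r\<close> at phase \<open>\<phi>\<close>.\<close>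

definition support_functional :: "real \<Rightarrow> real \<Rightarrow> complex \<Rightarrow> real" where
  "support_functional q \<phi> z = q powr \<phi> *
     (Re (z * exp (- (\<i> * of_real pi * of_real \<phi>))) +
      ln q / pi * Im (z * exp (- (\<i> * of_real pi * of_real \<phi>))))"

lemma support_functional_linear:
  "support_functional q \<phi> (z + w) = support_functional q \<phi> z + support_functional q \<phi> w"
  "support_functional q \<phi> (z - w) = support_functional q \<phi> z - support_functional q \<phi> w"
  "support_functional q \<phi> (- z) = - support_functional q \<phi> z"
  "support_functional q \<phi> 0 = 0"
  unfolding support_functional_def by (simp_all add: algebra_simps)

lemma support_functional_sum:
  "support_functional q \<phi> (\<Sum>i\<in>I. z i) = (\<Sum>i\<in>I. support_functional q \<phi> (z i))"
  by (induction I rule: infinite_finite_induct) (simp_all add: support_functional_linear)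

lemma ray_rotate:
  "of_real r * exp (\<i> * of_real pi * of_real \<psi>) * exp (- (\<i> * of_real pi * of_real \<phi>)) =
    of_real r * cis (pi * (\<psi> - \<phi>))"
  unfolding cis_conv_exp by (simp add: mult.assoc exp_add[symmetric] algebra_simps)

text \<open>Rotate by phase \<open>\<phi>\<close> and divide by \<open>q powr \<phi> * r\<close>.
  With \<open>\<delta> = pi * (\<psi> - \<phi>)\<close> and \<open>s = ln q / pi\<close>, the claim
  becomes \<open>cos_sin_less_exp\<close>, since \<open>exp (s * \<delta>)\<close> is
  \<open>q powr (\<psi> - \<phi>)\<close>.\<close>

lemma support_functional_ray:
  assumes "q > 0" "r > 0" and z: "z = of_real r * exp (\<i> * of_real pi * of_real \<psi>)"
  shows "\<lbrakk>\<bar>\<psi> - \<phi>\<bar> \<le> 1; \<psi> \<noteq> \<phi>\<rbrakk> \<Longrightarrow> support_functional q \<phi> z < q powr \<psi> * cmod z"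
    and "support_functional q \<psi> z = q powr \<psi> * cmod z"
proof -
  have cm: "cmod z = r"
    using assms by (simp add: norm_mult)
  have L: "support_functional q \<phi> z =
      q powr \<phi> * (r * (cos (pi * (\<psi> - \<phi>)) + ln q / pi * sin (pi * (\<psi> - \<phi>))))" for \<phi>
    unfolding support_functional_def z ray_rotate by (simp add: algebra_simps)
  show "support_functional q \<psi> z = q powr \<psi> * cmod z"
    unfolding L cm by simp
  assume d: "\<bar>\<psi> - \<phi>\<bar> \<le> 1" "\<psi> \<noteq> \<phi>"
  then have "\<bar>pi * (\<psi> - \<phi>)\<bar> \<le> pi"
    by (simp add: abs_mult)
  then have "cos (pi * (\<psi> - \<phi>)) + ln q / pi * sin (pi * (\<psi> - \<phi>)) <
      exp (ln q / pi * (pi * (\<psi> - \<phi>)))"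
    using d by (intro cos_sin_less_exp) auto
  also have "\<dots> = q powr (\<psi> - \<phi>)"
    using assms by (simp add: powr_def mult.commute)
  finally have "q powr \<phi> * (r * (cos (pi * (\<psi> - \<phi>)) + ln q / pi * sin (pi * (\<psi> - \<phi>)))) <
      q powr \<phi> * (r * q powr (\<psi> - \<phi>))"
    using assms by (intro mult_strict_left_mono) auto
  also have "\<dots> = q powr \<psi> * r"
    by (simp add: powr_diff assms)
  finally show "support_functional q \<phi> z < q powr \<psi> * cmod z"
    unfolding L cm .
qed

section \<open>The mass inequality for a triangle with semistable middle term\<close>

context central_charge_slicing
begin

lemma cl_singleton: "x \<in> P \<phi> \<Longrightarrow> x \<in> cl {\<phi>}"
  using cl_base by blast

text \<open>For \<open>w\<close> of phases above \<open>\<phi> + 1\<close> there are no nonzero maps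
  to \<open>x\<close> or to \<open>ShO C x\<close>, the neighbours of \<open>h\<close> in the long
  sequence.\<close>

lemma connecting_post_bij:
  assumes d: "dtri a x b f g h" and x: "x \<in> P \<phi>"
  shows "post_bij (cl {\<phi> + 1<..}) h b (ShO C a)"
proof (rule post_bijI)
  note H = dtri_Hom[OF d]
  show "h \<in> Hom C b (ShO C a)" by (fact H)
  show "\<exists>v \<in> Hom C w b. u = h \<cdot> v" if w: "w \<in> cl {\<phi> + 1<..}" and u: "u \<in> Hom C w (ShO C a)" for w u
  proof -
    have "ShA C f \<cdot> u = Zero C w (ShO C x)"
      using cl_Hom[OF w cl_singleton[OF P_ShO[OF x]] _ Comp_closed[OF u ShA_closed[OF H(1)]]] by simp
    then show ?thesis
      using dtri_lift2[OF d u] by metis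
  qed
  show "u = Zero C w b" if w: "w \<in> cl {\<phi> + 1<..}" and u: "u \<in> Hom C w b" "h \<cdot> u = Zero C w (ShO C a)"
    for w u
  proof -
    obtain v where v: "v \<in> Hom C w x" "u = g \<cdot> v"
      using dtri_lift[OF dtri_rotate[OF d] u] .
    have "v = Zero C w x"
      using cl_Hom[OF w cl_singleton[OF x] _ v(1)] by simp
    then show ?thesis
      using v Comp_Zero[OF H(2)] Hom_Ob(1)[OF u(1)] by simp
  qed
qed

text \<open>Dually, neither \<open>x\<close> nor \<open>ShO C x\<close> has nonzero maps to objects
  of phases below \<open>\<phi>\<close>.\<close>

lemma connecting_pre_bij:
  assumes d: "dtri a x b f g h" and x: "x \<in> P \<phi>"
  shows "pre_bij (cl (- {\<phi>..})) h b (ShO C a)"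
proof (rule pre_bijI)
  note H = dtri_Hom[OF d]
  show "h \<in> Hom C b (ShO C a)" by (fact H)
  show "\<exists>v \<in> Hom C (ShO C a) w. u = v \<cdot> h" if w: "w \<in> cl (- {\<phi>..})" and u: "u \<in> Hom C b w" for w u
  proof -
    have "u \<cdot> g = Zero C x w"
      using cl_Hom[OF cl_singleton[OF x] w _ Comp_closed[OF H(2) u]] by simp
    then show ?thesis
      using dtri_extend[OF dtri_rotate[OF d] u] by metis
  qed
  show "u = Zero C (ShO C a) w"
    if w: "w \<in> cl (- {\<phi>..})" and u: "u \<in> Hom C (ShO C a) w" "u \<cdot> h = Zero C b w" for w u
  proof -
    obtain v where v: "v \<in> Hom C (ShO C x) w" "u = v \<cdot> ShA C f"
      using dtri_extend2[OF d u] .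
    have "v = Zero C (ShO C x) w"
      using cl_Hom[OF cl_singleton[OF P_ShO[OF x]] w _ v(1)] by fastforce
    then show ?thesis
      using v Zero_Comp[OF ShA_closed[OF H(1)]] Hom_Ob(2)[OF u(1)] by simp
  qed
qed

text \<open>Upper parts above \<open>\<phi> + 1\<close> and lower parts below \<open>\<phi>\<close>
  of \<open>b\<close> and \<open>ShO C a\<close> are identified through \<open>h\<close>. Those of
  \<open>ShO C a\<close> are shifts of parts of \<open>a\<close>, and the shift changes the sign of
  the charge.\<close>

lemma connecting_truncations:
  assumes d: "dtri a x b f g h" and x: "x \<in> P \<phi>"
    and a: "truncation {\<phi><..} a t y" "truncation {\<phi> - 1..} a u v"
    and b: "truncation {\<phi> + 1<..} b t' y'" "truncation {\<phi>..} b u' v'"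
  shows "Z t' = - Z t" "Z v' = - Z v"
proof -
  \<comment> \<open>The cuts for \<open>a\<close> lie one phase below those for \<open>b\<close>,
    because \<open>b\<close> is compared with \<open>ShO C a\<close>.\<close>
  have I: "(\<lambda>\<phi>. \<phi> + 1) ` {\<phi><..} = {\<phi> + 1<..}" "(\<lambda>\<phi>. \<phi> + 1) ` {\<phi> - 1..} = {\<phi>..}"
    by (auto intro!: image_eqI[of _ _ "_ - 1"])
  have O: "t \<in> Ob C" "v \<in> Ob C"
    using a cl_Ob unfolding truncation_def by auto
  have a': "truncation {\<phi> + 1<..} (ShO C a) (ShO C t) (ShO C y)"
    "truncation {\<phi>..} (ShO C a) (ShO C u) (ShO C v)"
    using truncation_ShO[OF a(1)] truncation_ShO[OF a(2)] unfolding I by auto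
  show "Z t' = - Z t"
  proof -
    obtain s p r where s: "dtri t' b y' s p r" "t' \<in> cl {\<phi> + 1<..}" "y' \<in> cl (- {\<phi> + 1<..})"
      using b(1) unfolding truncation_def by blast
    obtain s' p' r' where s': "dtri (ShO C t) (ShO C a) (ShO C y) s' p' r'"
      "ShO C t \<in> cl {\<phi> + 1<..}" "ShO C y \<in> cl (- {\<phi> + 1<..})"
      using a'(1) unfolding truncation_def by blast
    \<comment> \<open>Following \<open>t' -> b\<close> by \<open>h\<close> gives a second
      coreflection of \<open>ShO C a\<close>, besides the shifted truncation of
      \<open>a\<close>.\<close>
    have "isomorphic C t' (ShO C t)"
      using post_bij_isomorphic[OF
          post_bij_comp[OF truncation_post_bij[OF cut_greaterThan s] connecting_post_bij[OF d x]] s(2)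
          truncation_post_bij[OF cut_greaterThan s'] s'(2)] .
    then show ?thesis
      using Z_isomorphic Z_ShO[OF O(1)] by simp
  qed
  show "Z v' = - Z v"
  proof -
    obtain s p r where s: "dtri u' b v' s p r" "u' \<in> cl {\<phi>..}" "v' \<in> cl (- {\<phi>..})"
      using b(2) unfolding truncation_def by blast
    obtain s' p' r' where s': "dtri (ShO C u) (ShO C a) (ShO C v) s' p' r'"
      "ShO C u \<in> cl {\<phi>..}" "ShO C v \<in> cl (- {\<phi>..})"
      using a'(2) unfolding truncation_def by blast
    have "isomorphic C v' (ShO C v)"
      using pre_bij_isomorphic[OF truncation_pre_bij[OF cut_atLeast s] s(3)
          pre_bij_comp[OF connecting_pre_bij[OF d x] truncation_pre_bij[OF cut_atLeast s']] s'(3)] .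
    then show ?thesis
      using Z_isomorphic Z_ShO[OF O(2)] by simp
  qed
qed

lemma truncation_Z: "truncation U x t y \<Longrightarrow> Z x = Z t + Z y"
  unfolding truncation_def using Z_add by blast

text \<open>The outer parts cancel by \<open>connecting_truncations\<close>. The windows that remain
  lie within distance one of \<open>\<phi>\<close>, exactly where the support inequality is
  available.\<close>

lemma middle_factors:
  assumes d: "dtri a x b f g h" and x: "x \<in> P \<phi>"
    and a: "HN_filtration C P a n E \<alpha> A" and b: "HN_filtration C P b m F \<beta> B"
  shows "Z x = (\<Sum>j<n. if \<phi> - 1 \<le> \<alpha> j \<and> \<alpha> j \<le> \<phi> then Z (A j) else 0) +
    (\<Sum>j<m. if \<phi> \<le> \<beta> j \<and> \<beta> j \<le> \<phi> + 1 then Z (B j) else 0)"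
proof -
  obtain t y where ty: "truncation {\<phi><..} a t y"
      "Z t = (\<Sum>j<n. if \<alpha> j \<in> {\<phi><..} then Z (A j) else 0)"
    using HN_truncation[OF a cut_greaterThan] by blast
  obtain u v where uv: "truncation {\<phi> - 1..} a u v"
      "Z u = (\<Sum>j<n. if \<alpha> j \<in> {\<phi> - 1..} then Z (A j) else 0)"
    using HN_truncation[OF a cut_atLeast] by blast
  obtain t' y' where ty': "truncation {\<phi> + 1<..} b t' y'"
      "Z t' = (\<Sum>j<m. if \<beta> j \<in> {\<phi> + 1<..} then Z (B j) else 0)"
    using HN_truncation[OF b cut_greaterThan] by blast
  obtain u' v' where uv': "truncation {\<phi>..} b u' v'"
      "Z u' = (\<Sum>j<m. if \<beta> j \<in> {\<phi>..} then Z (B j) else 0)"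
    using HN_truncation[OF b cut_atLeast] by blast
  have "Z a + Z b = (Z u - Z t) + (Z u' - Z t')"
    using connecting_truncations[OF d x ty(1) uv(1) ty'(1) uv'(1)]
      truncation_Z[OF uv(1)] truncation_Z[OF uv'(1)] by simp
  moreover have "Z u - Z t = (\<Sum>j<n. if \<phi> - 1 \<le> \<alpha> j \<and> \<alpha> j \<le> \<phi> then Z (A j) else 0)"
    unfolding uv ty sum_subtractf[symmetric] by (rule sum.cong) auto
  moreover have "Z u' - Z t' = (\<Sum>j<m. if \<phi> \<le> \<beta> j \<and> \<beta> j \<le> \<phi> + 1 then Z (B j) else 0)"
    unfolding uv' ty' sum_subtractf[symmetric] by (rule sum.cong) auto
  ultimately show ?thesis
    using Z_add[OF d] by simp
qed

text \<open>\<open>mass\<close> without its separate case for zero objects, where the empty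
  filtration gives 0 anyway.\<close>

definition hn_mass :: "real \<Rightarrow> 'o \<Rightarrow> real" where
  "hn_mass q x = (THE m. \<exists>n E \<phi> A. HN_filtration C P x n E \<phi> A \<and>
     m = (\<Sum>j<n. q powr \<phi> j * cmod (Z (A j))))"

lemma hn_mass_eq:
  assumes "HN_filtration C P x n E \<phi> A"
  shows "hn_mass q x = (\<Sum>j<n. q powr \<phi> j * cmod (Z (A j)))"
  unfolding hn_mass_def
proof (rule the_equality)
  show "\<exists>n' E' \<phi>' A'. HN_filtration C P x n' E' \<phi>' A' \<and>
      (\<Sum>j<n. q powr \<phi> j * cmod (Z (A j))) = (\<Sum>j<n'. q powr \<phi>' j * cmod (Z (A' j)))"
    using assms by blast
next
  fix m assume "\<exists>n' E' \<phi>' A'. HN_filtration C P x n' E' \<phi>' A' \<and>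
      m = (\<Sum>j<n'. q powr \<phi>' j * cmod (Z (A' j)))"
  then show "m = (\<Sum>j<n. q powr \<phi> j * cmod (Z (A j)))"
    using HN_sum_unique[OF assms, of _ _ _ _ "\<lambda>c. q powr c"] by metis
qed

lemma hn_mass_zero:
  assumes "zero_object C x"
  shows "hn_mass q x = 0"
proof -
  have "HN_filtration C P x 0 (\<lambda>_. x) (\<lambda>_. 0) (\<lambda>_. x)"
    using assms unfolding HN_filtration_def by simp
  then show ?thesis
    using hn_mass_eq by fastforce
qed

lemma HN_semistable:
  assumes "x \<in> P \<phi>" "\<not> zero_object C x" "zero_object C e"
  shows "HN_filtration C P x 1 (\<lambda>j. if j = 0 then e else x) (\<lambda>_. \<phi>) (\<lambda>_. x)"
  using dtri_zero_Id[OF P_Ob[OF assms(1)] assms(3)] assms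
  unfolding HN_filtration_def dtri_def by auto

text \<open>On a single ray the functional and the mass agree, so on \<open>P \<phi>\<close> the
  mass is linear in the charge and hence additive on triangles inside
  \<open>P \<phi>\<close>.\<close>

lemma hn_mass_semistable:
  assumes q: "q > 0" and x: "x \<in> P \<phi>"
  shows "hn_mass q x = support_functional q \<phi> (Z x)"
proof (cases "zero_object C x")
  case True
  then show ?thesis
    using hn_mass_zero Z_zero support_functional_linear(4) by simp
next
  case False
  obtain e where "zero_object C e"
    using ex_zero_object by blast
  then have "hn_mass q x = q powr \<phi> * cmod (Z x)"
    using hn_mass_eq[OF HN_semistable[OF x False]] by simp
  then show ?thesis
    using Z_ray[OF x False] support_functional_ray(2)[OF q] by metis
qed

lemma HN_term_pos:
  assumes "q > (0::real)" "HN_filtration C P x n E \<phi> A" "j < n"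
  shows "0 < q powr \<phi> j * cmod (Z (A j))"
  using Z_nonzero[OF HN_factor[OF assms(2,3)]] assms(1) by simp

text \<open>Strictly decreasing phases leave room for at most one factor, and a filtration of length
  one starting at zero identifies \<open>x\<close> with it.\<close>

lemma HN_single_phase:
  assumes HN: "HN_filtration C P x n E \<phi> A" and c: "\<And>j. j < n \<Longrightarrow> \<phi> j = c"
  shows "x \<in> P c"
proof (cases n)
  case 0
  then show ?thesis
    using HN HN_zero P_zero by blast
next
  case (Suc k)
  have "k = 0"
    using HN_phase_less[OF HN, of 0 1] c[of 0] c[of 1] Suc by fastforce
  then have HN: "HN_filtration C P x (Suc 0) E \<phi> A" and "\<phi> 0 = c"
    using HN Suc c by auto
  moreover obtain f g h where d: "dtri (E 0) x (A 0) f g h"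
    using HN_Suc(2)[OF HN] by blast
  moreover have "isomorphic C x (A 0)"
    using dtri_zero_isomorphic[OF d HN_zero[OF HN_Suc(1)[OF HN]]] .
  ultimately show ?thesis
    using P_isomorphic isomorphic_sym HN_Suc(3)[OF HN] by metis
qed

lemma mass_triangle_strict:
  assumes q: "q > 0" and d: "dtri a x b f g h" and x: "x \<in> P \<phi>"
    and ab: "\<not> (a \<in> P \<phi> \<and> b \<in> P \<phi>)"
  shows "hn_mass q x < hn_mass q a + hn_mass q b"
proof -
  obtain n E \<alpha> A m F \<beta> B
    where a: "HN_filtration C P a n E \<alpha> A" and b: "HN_filtration C P b m F \<beta> B"
    using HN_ex dtri_Hom[OF d] by metis
  let ?L = "support_functional q \<phi>"
  \<comment> \<open>The bounds \<open>c\<close> and \<open>c'\<close> are free so that one estimate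
    serves the windows of both \<open>a\<close> and \<open>b\<close>. A factor outside its window
    contributes 0, less than its mass.\<close>
  have le: "(if c \<le> \<psi> \<and> \<psi> \<le> c' then ?L (Z w) else 0) \<le> q powr \<psi> * cmod (Z w)"
    and less: "\<psi> \<noteq> \<phi> \<Longrightarrow>
      (if c \<le> \<psi> \<and> \<psi> \<le> c' then ?L (Z w) else 0) < q powr \<psi> * cmod (Z w)"
    if w: "w \<in> P \<psi>" "\<not> zero_object C w" and c: "\<phi> - 1 \<le> c" "c' \<le> \<phi> + 1" for \<psi> w c c'
  proof -
    obtain r where r: "r > 0" "Z w = of_real r * exp (\<i> * of_real pi * of_real \<psi>)"
      using Z_ray[OF w] by blast
    have pos: "0 < q powr \<psi> * cmod (Z w)"
      using Z_nonzero[OF w] q by simp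
    show l: "\<psi> \<noteq> \<phi> \<Longrightarrow>
        (if c \<le> \<psi> \<and> \<psi> \<le> c' then ?L (Z w) else 0) < q powr \<psi> * cmod (Z w)"
      using support_functional_ray(1)[OF q r, of \<phi>] pos c by auto
    show "(if c \<le> \<psi> \<and> \<psi> \<le> c' then ?L (Z w) else 0) \<le> q powr \<psi> * cmod (Z w)"
      using support_functional_ray(2)[OF q r] pos l by (cases "\<psi> = \<phi>") auto
  qed
  define la where "la = (\<lambda>j. if \<phi> - 1 \<le> \<alpha> j \<and> \<alpha> j \<le> \<phi> then ?L (Z (A j)) else 0)"
  define lb where "lb = (\<lambda>j. if \<phi> \<le> \<beta> j \<and> \<beta> j \<le> \<phi> + 1 then ?L (Z (B j)) else 0)"
  define ma where "ma = (\<lambda>j. q powr \<alpha> j * cmod (Z (A j)))"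
  define mb where "mb = (\<lambda>j. q powr \<beta> j * cmod (Z (B j)))"
  have la: "\<forall>j\<in>{..<n}. la j \<le> ma j" and lb: "\<forall>j\<in>{..<m}. lb j \<le> mb j"
    unfolding la_def ma_def lb_def mb_def using HN_factor[OF a] HN_factor[OF b] le by auto
  have "?L (Z x) = sum la {..<n} + sum lb {..<m}"
    unfolding middle_factors[OF d x a b] support_functional_linear support_functional_sum
      la_def lb_def by (simp add: if_distrib support_functional_linear cong: if_cong)
  moreover have "sum la {..<n} + sum lb {..<m} < sum ma {..<n} + sum mb {..<m}"
  \<comment> \<open>Some factor has phase other than \<open>\<phi>\<close> and makes the sum strict:
    if none occurs in \<open>a\<close>, then \<open>a\<close> lies in \<open>P \<phi>\<close>, so
    one must occur in \<open>b\<close>.\<close>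
  proof (cases "\<exists>j<n. \<alpha> j \<noteq> \<phi>")
    case True
    then obtain j where j: "j < n" "\<alpha> j \<noteq> \<phi>"
      by blast
    then have "\<exists>j\<in>{..<n}. la j < ma j"
      unfolding la_def ma_def using less[OF HN_factor[OF a j(1)] _ _ j(2), of "\<phi> - 1" \<phi>] j(1)
      by (intro bexI[of _ j]) simp_all
    then show ?thesis
      using sum_strict_mono_ex1[OF _ la] sum_mono[of "{..<m}" lb mb] lb by fastforce
  next
    case False
    then have "a \<in> P \<phi>"
      using HN_single_phase[OF a] by blast
    then obtain j where j: "j < m" "\<beta> j \<noteq> \<phi>"
      using HN_single_phase[OF b] ab by blast
    then have "\<exists>j\<in>{..<m}. lb j < mb j"
      unfolding lb_def mb_def using less[OF HN_factor[OF b j(1)] _ _ j(2), of \<phi> "\<phi> + 1"] j(1)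
      by (intro bexI[of _ j]) simp_all
    then show ?thesis
      using sum_strict_mono_ex1[OF _ lb] sum_mono[of "{..<n}" la ma] la by fastforce
  qed
  ultimately show ?thesis
    using hn_mass_semistable[OF q x] hn_mass_eq[OF a] hn_mass_eq[OF b] unfolding ma_def mb_def by simp
qed

section \<open>Monomorphisms between semistable objects of one phase\<close>

lemma full_subcat_simps:
  "Ob (full_subcat C S) = S" "f \<in> Arr (full_subcat C S) \<longleftrightarrow> f \<in> Arr C \<and> Dom C f \<in> S \<and> Cod C f \<in> S"
  "Dom (full_subcat C S) = Dom C" "Cod (full_subcat C S) = Cod C" "Id (full_subcat C S) = Id C"
  "Comp (full_subcat C S) = Comp C"
  unfolding full_subcat_def by auto

lemma monic_full_subcat:
  assumes f: "f \<in> Hom C y x" and P: "y \<in> P \<phi>" "x \<in> P \<phi>"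
  shows "monic (full_subcat C (P \<phi>)) f \<longleftrightarrow>
    (\<forall>w \<in> P \<phi>. \<forall>u \<in> Hom C w y. f \<cdot> u = Zero C w x \<longrightarrow> u = Zero C w y)"
proof -
  have D: "f \<in> Arr C" "Dom C f = y" "Cod C f = x"
    using f by (auto simp: Hom_def)
  have m: "monic (full_subcat C (P \<phi>)) f \<longleftrightarrow>
      (\<forall>w \<in> P \<phi>. \<forall>u \<in> Hom C w y. \<forall>v \<in> Hom C w y. f \<cdot> u = f \<cdot> v \<longrightarrow> u = v)"
    unfolding monic_def full_subcat_simps D using P D Hom_full_subcat by simp
  show ?thesis
  proof
    assume *: "monic (full_subcat C (P \<phi>)) f"
    show "\<forall>w \<in> P \<phi>. \<forall>u \<in> Hom C w y. f \<cdot> u = Zero C w x \<longrightarrow> u = Zero C w y"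
    proof (intro ballI impI)
      fix w u assume w: "w \<in> P \<phi>" and u: "u \<in> Hom C w y" "f \<cdot> u = Zero C w x"
      have "f \<cdot> u = f \<cdot> Zero C w y"
        using u Comp_Zero[OF f P_Ob[OF w]] by simp
      then show "u = Zero C w y"
        using * u(1) w Zero_closed[OF P_Ob[OF w] P_Ob[OF P(1)]] unfolding m by blast
    qed
  next
    assume *: "\<forall>w \<in> P \<phi>. \<forall>u \<in> Hom C w y. f \<cdot> u = Zero C w x \<longrightarrow> u = Zero C w y"
    show "monic (full_subcat C (P \<phi>)) f"
      unfolding m
    proof (intro ballI impI)
      fix w u v assume w: "w \<in> P \<phi>" and u: "u \<in> Hom C w y" "v \<in> Hom C w y" "f \<cdot> u = f \<cdot> v"
      show "u = v"
        by (rule zero_kernel_inj[OF f _ u]) (use * w in blast)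
    qed
  qed
qed

lemma isomorphism_full_subcat:
  assumes f: "f \<in> Hom C y x" and P: "y \<in> P \<phi>" "x \<in> P \<phi>"
  shows "isomorphism (full_subcat C (P \<phi>)) f \<longleftrightarrow> isomorphism C f"
proof -
  have D: "f \<in> Arr C" "Dom C f = y" "Cod C f = x"
    using f by (auto simp: Hom_def)
  show ?thesis
    unfolding isomorphism_def full_subcat_simps D using P D Hom_full_subcat by simp
qed

text \<open>It remains to exclude \<open>a\<close> and \<open>b\<close> both in
  \<open>P \<phi>\<close>. Then \<open>f\<close> would be monic there, since maps from phase
  \<open>\<phi> + 1\<close> to \<open>b\<close> vanish; simplicity would make it an isomorphism and
  its cone \<open>b\<close> zero.\<close>

lemma stable_mass_strict:
  assumes q: "q > 0" and s: "simple_object (full_subcat C (P \<phi>)) x"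
    and d: "dtri a x b f g h" and ab: "\<not> zero_object C a" "\<not> zero_object C b"
  shows "hn_mass q x < hn_mass q a + hn_mass q b"
proof (rule mass_triangle_strict[OF q d])
  note H = dtri_Hom[OF d]
  show x: "x \<in> P \<phi>"
    using s unfolding simple_object_def full_subcat_simps by blast
  show "\<not> (a \<in> P \<phi> \<and> b \<in> P \<phi>)"
  proof
    assume ab': "a \<in> P \<phi> \<and> b \<in> P \<phi>"
    have "u = Zero C w a" if w: "w \<in> P \<phi>" and u: "u \<in> Hom C w a" "f \<cdot> u = Zero C w x" for w u
    proof -
      have "ShA C f \<cdot> ShA C u = Zero C (ShO C w) (ShO C x)"
        using ShA_Comp[OF u(1) H(1)] u ShA_Zero[OF P_Ob[OF w] H(5)] by simp
      then obtain v where v: "v \<in> Hom C (ShO C w) b" "ShA C u = h \<cdot> v"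
        using dtri_lift2[OF d ShA_closed[OF u(1)]] by metis
      have "v = Zero C (ShO C w) b"
        using P_Hom[OF _ P_ShO[OF w] _ v(1), of \<phi>] ab' by simp
      then show ?thesis
        using v Comp_Zero[OF H(3) ShO_closed[OF P_Ob[OF w]]] ShA_eq_Zero[OF u(1)] by simp
    qed
    then have "monic (full_subcat C (P \<phi>)) f"
      using monic_full_subcat[OF H(1)] ab' x by blast
    moreover have "Cod C f = x" "Dom C f = a"
      using H by (auto simp: Hom_def)
    ultimately have "isomorphism (full_subcat C (P \<phi>)) f"
      using s ab(1) zero_object_full_subcat unfolding simple_object_def full_subcat_simps by blast
    then show False
      using isomorphism_full_subcat[OF H(1)] ab' x dtri_iso_zero[OF d] ab(2) by blast
  qed
qed

text \<open>Rotation sends the phases from \<open>\<phi>\<close> to \<open>\<phi> + 1\<close> to the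
  closed upper half-plane, the two end phases being the ones on the real axis.\<close>

lemma Im_rotated:
  assumes "a \<in> P \<psi>" "\<not> zero_object C a" "\<phi> \<le> \<psi>" "\<psi> \<le> \<phi> + 1"
  shows "0 \<le> Im (Z a * exp (- (\<i> * of_real pi * of_real \<phi>)))"
    "Im (Z a * exp (- (\<i> * of_real pi * of_real \<phi>))) = 0 \<longleftrightarrow> \<psi> = \<phi> \<or> \<psi> = \<phi> + 1"
proof -
  obtain r where r: "r > 0" "Z a = of_real r * exp (\<i> * of_real pi * of_real \<psi>)"
    using Z_ray[OF assms(1,2)] by blast
  have I: "Im (Z a * exp (- (\<i> * of_real pi * of_real \<phi>))) = r * sin (pi * (\<psi> - \<phi>))"
    unfolding r(2) ray_rotate by simp
  show "0 \<le> Im (Z a * exp (- (\<i> * of_real pi * of_real \<phi>)))"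
    unfolding I using r assms by (intro mult_nonneg_nonneg sin_ge_zero) auto
  have "0 < sin (pi * (\<psi> - \<phi>))" if "\<phi> < \<psi>" "\<psi> < \<phi> + 1"
    using that by (intro sin_gt_zero) auto
  moreover have "sin (pi * (\<psi> - \<phi>)) = 0" if "\<psi> = \<phi> \<or> \<psi> = \<phi> + 1"
    using that by auto
  ultimately show "Im (Z a * exp (- (\<i> * of_real pi * of_real \<phi>))) = 0 \<longleftrightarrow> \<psi> = \<phi> \<or> \<psi> = \<phi> + 1"
    unfolding I using r assms(3,4) by fastforce
qed

lemma Im_rotated_semistable:
  assumes "a \<in> P \<phi>"
  shows "Im (Z a * exp (- (\<i> * of_real pi * of_real \<phi>))) = 0"
  using Im_rotated(2)[OF assms] Z_zero[of a] by (cases "zero_object C a") auto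

text \<open>As an extension of \<open>ShO C y\<close> by \<open>x\<close>, the cone has phases
  between \<open>\<phi>\<close> and \<open>\<phi> + 1\<close>. Its rotated charge is real, and the
  nonnegative imaginary parts of its factors sum to zero, so all of them vanish.\<close>

lemma cone_phases:
  assumes d: "dtri y x b f g h" and P: "y \<in> P \<phi>" "x \<in> P \<phi>"
    and HN: "HN_filtration C P b n E \<beta> B" "j < n"
  shows "\<beta> j = \<phi> \<or> \<beta> j = \<phi> + 1"
proof -
  let ?I = "\<lambda>w. Im (w * exp (- (\<i> * of_real pi * of_real \<phi>)))"
  have "x \<in> cl {\<phi>, \<phi> + 1}" "ShO C y \<in> cl {\<phi>, \<phi> + 1}"
    using cl_base P P_ShO by blast+
  then have "b \<in> cl {\<phi>, \<phi> + 1}"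
    by (rule cl_dtri[OF dtri_rotate[OF d]])
  then have range: "\<phi> \<le> \<beta> i" "\<beta> i \<le> \<phi> + 1" if "i < n" for i
    using HN_phase_in[OF _ HN(1) that] by fastforce+
  have "(\<Sum>i<n. ?I (Z (B i))) = ?I (Z b)"
    unfolding HN_Z[OF HN(1)] sum_distrib_right Im_sum ..
  also have "\<dots> = ?I (Z x) - ?I (Z y)"
    using Z_add[OF d] by (simp add: algebra_simps)
  also have "\<dots> = 0"
    using Im_rotated_semistable P by simp
  finally have "?I (Z (B j)) = 0"
    using sum_nonneg_0[of "{..<n}" "\<lambda>i. ?I (Z (B i))" j]
      Im_rotated(1)[OF HN_factor[OF HN(1)] range] HN(2) by simp
  then show ?thesis
    using Im_rotated(2)[OF HN_factor[OF HN] range[OF HN(2)]] by simp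
qed

text \<open>By \<open>cone_phases\<close> the only obstruction is a part of phase
  \<open>\<phi> + 1\<close>. The trivial kernel of \<open>f\<close> excludes it, because
  \<open>b\<close> then receives no nonzero map from \<open>P (\<phi> + 1)\<close>.\<close>

lemma cone_of_mono:
  assumes d: "dtri y x b f g h" and P: "y \<in> P \<phi>" "x \<in> P \<phi>"
    and mono: "\<And>w u. \<lbrakk>w \<in> P \<phi>; u \<in> Hom C w y; f \<cdot> u = Zero C w x\<rbrakk> \<Longrightarrow> u = Zero C w y"
  shows "b \<in> P \<phi>"
proof -
  note H = dtri_Hom[OF d]
  \<comment> \<open>Up to isomorphism \<open>t\<close> is a shift, so \<open>h \<cdot> s\<close>
    comes from a map \<open>k -> y\<close> killed by \<open>f\<close>, which is zero by
    \<open>mono\<close>. Hence \<open>s\<close> lifts to \<open>x\<close>, and maps from phase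
    \<open>\<phi> + 1\<close> to \<open>x\<close> vanish.\<close>
  have top: "s = Zero C t b" if t: "t \<in> P (\<phi> + 1)" and s: "s \<in> Hom C t b" for t s
  proof -
    obtain k where k: "k \<in> P \<phi>" "isomorphic C (ShO C k) t"
      using P_unshift[OF t] by blast
    then obtain i where i: "i \<in> Hom C (ShO C k) t" "isomorphism C i"
      unfolding isomorphic_def by blast
    then obtain i' where i': "i' \<in> Hom C t (ShO C k)" "i \<cdot> i' = Id C t"
      using isomorphismE by blast
    have hs: "h \<cdot> s \<in> Hom C t (ShO C y)"
      using Comp_closed[OF s H(3)] .
    obtain u where u: "u \<in> Hom C k y" "(h \<cdot> s) \<cdot> i = ShA C u"
      using ShA_surjE[OF Comp_closed[OF i(1) hs] P_Ob[OF k(1)] H(4)] .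
    have "ShA C f \<cdot> (h \<cdot> s) = Zero C t (ShO C x)"
      using Comp_assoc[OF s H(3) ShA_closed[OF H(1)]] dtri_comp_ShA[OF d]
        Zero_Comp[OF s ShO_closed[OF H(5)]] by simp
    then have "ShA C f \<cdot> ShA C u = Zero C (ShO C k) (ShO C x)"
      using Comp_assoc[OF i(1) hs ShA_closed[OF H(1)]] u(2)
        Zero_Comp[OF i(1) ShO_closed[OF H(5)]] by simp
    then have "f \<cdot> u = Zero C k x"
      using ShA_Comp[OF u(1) H(1)] ShA_eq_Zero[OF Comp_closed[OF u(1) H(1)]] by simp
    then have "(h \<cdot> s) \<cdot> i = Zero C (ShO C k) (ShO C y)"
      using mono[OF k(1) u(1)] u ShA_eq_Zero by simp
    then have "(h \<cdot> s) \<cdot> (i \<cdot> i') = Zero C t (ShO C y)"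
      using Comp_assoc[OF i'(1) i(1) hs] Zero_Comp[OF i'(1) ShO_closed[OF H(4)]] by simp
    then have "h \<cdot> s = Zero C t (ShO C y)"
      using i' Comp_Id[OF hs] by simp
    then obtain v where v: "v \<in> Hom C t x" "s = g \<cdot> v"
      using dtri_lift[OF dtri_rotate[OF d] s] by blast
    have "v = Zero C t x"
      using P_Hom[OF _ t P(2) v(1)] by simp
    then show ?thesis
      using v Comp_Zero[OF H(2) P_Ob[OF t]] by simp
  qed
  obtain n E \<beta> B where HN: "HN_filtration C P b n E \<beta> B"
    using HN_ex[OF H(6)] by blast
  note ph = cone_phases[OF d P HN]
  show ?thesis
  proof (cases n)
    case 0
    then show ?thesis
      using HN HN_zero P_zero by blast
  next
    case (Suc k)
    note HN' = HN[unfolded Suc]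
    have above: "\<beta> k < \<beta> j" if "j < k" for j
      using HN_phase_less[OF HN' that] by simp
    obtain s p r where s: "dtri (E k) b (B k) s p r"
      using HN_Suc(2)[OF HN'] by blast
    show ?thesis
    proof (cases "\<beta> k = \<phi>")
      case True
      have "\<beta> j = \<phi> + 1" if "j < k" for j
        using ph[of j] above[OF that] that Suc True by auto
      then have t: "E k \<in> P (\<phi> + 1)"
        using HN_single_phase[OF HN_Suc(1)[OF HN']] by blast
      have B: "B k \<in> P \<phi>"
        using HN_Suc(3)[OF HN'] True by simp
      have t': "E k \<in> cl {\<phi> + 1..}" and "B k \<in> cl (- {\<phi> + 1..})"
        using cl_base[OF t] cl_base[OF B] by auto
      \<comment> \<open>\<open>E k\<close> is the part of phase \<open>\<phi> + 1\<close>.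
        Composition with \<open>s\<close> is injective on its endomorphisms, while \<open>s\<close>
        vanishes by \<open>top\<close>; so the identity of \<open>E k\<close> is zero.\<close>
      then have "post_bij (cl {\<phi> + 1..}) s (E k) b"
        using truncation_post_bij[OF cut_atLeast s] by blast
      then have inj: "inj_on (\<lambda>u. s \<cdot> u) (Hom C (E k) (E k))"
        using post_bijD(2) t' bij_betw_imp_inj_on by blast
      have O: "E k \<in> Ob C"
        using P_Ob[OF t] .
      have "s = Zero C (E k) b"
        using top[OF t dtri_Hom(1)[OF s]] .
      then have "s \<cdot> Id C (E k) = s \<cdot> Zero C (E k) (E k)"
        using Comp_Id[OF dtri_Hom(1)[OF s]] Comp_Zero[OF dtri_Hom(1)[OF s] O] by simp
      then have "zero_object C (E k)"
        using inj_onD[OF inj _ Id_closed[OF O] Zero_closed[OF O O]] zero_object_iff O by blast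
      then show ?thesis
        using dtri_zero_isomorphic[OF s] isomorphic_sym P_isomorphic[OF B] by blast
    next
      case False
      \<comment> \<open>Now the lowest phase is already \<open>\<phi> + 1\<close>, so all of
        \<open>b\<close> has this phase and \<open>top\<close> applies to its identity.\<close>
      then have k: "\<beta> k = \<phi> + 1"
        using ph[of k] Suc by simp
      have "\<beta> j = \<phi> + 1" if "j < n" for j
        using ph[OF that] above[of j] k that Suc by (cases "j = k") auto
      then have b: "b \<in> P (\<phi> + 1)"
        using HN_single_phase[OF HN] by blast
      then have "zero_object C b"
        using top[OF b Id_closed[OF H(6)]] zero_object_iff H(6) by blast
      then show ?thesis
        using P_zero by blast
    qed
  qed
qed

lemma not_stable_decomposition:
  assumes q: "q > 0" and x: "x \<in> Ob C" "\<not> zero_object C x"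
    and ns: "\<nexists>\<phi>. simple_object (full_subcat C (P \<phi>)) x"
  shows "\<exists>a b f g h. dtri a x b f g h \<and> \<not> zero_object C a \<and> \<not> zero_object C b \<and>
    hn_mass q x = hn_mass q a + hn_mass q b"
proof -
  obtain n E \<phi> A where HN: "HN_filtration C P x n E \<phi> A"
    using HN_ex[OF x(1)] by blast
  then obtain k where n: "n = Suc k"
    using x HN_zero by (cases n) auto
  note HN' = HN[unfolded n]
  obtain f g h where d: "dtri (E k) x (A k) f g h"
    using HN_Suc(2)[OF HN'] by blast
  note A = HN_Suc(3,4)[OF HN']
  obtain e where e: "zero_object C e"
    using ex_zero_object by blast
  show ?thesis
  proof (cases "k = 0")
    case False
    have "hn_mass q (A k) = q powr \<phi> k * cmod (Z (A k))"
      using hn_mass_eq[OF HN_semistable[OF A e]] by simp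
    then have sum: "hn_mass q x = hn_mass q (E k) + hn_mass q (A k)"
      using hn_mass_eq[OF HN'] hn_mass_eq[OF HN_Suc(1)[OF HN']] by simp
    \<comment> \<open>Nonvanishing of \<open>E k\<close> is read off from its mass: it has
      \<open>k > 0\<close> factors, while zero objects have mass 0.\<close>
    have "0 < hn_mass q (E k)"
      unfolding hn_mass_eq[OF HN_Suc(1)[OF HN']]
      using False HN_term_pos[OF q HN_Suc(1)[OF HN']] by (intro sum_pos) auto
    then have "\<not> zero_object C (E k)"
      using hn_mass_zero by force
    then show ?thesis
      using d A sum by blast
  next
    case True
    then have "x \<in> P (\<phi> 0)"
      using HN_single_phase[OF HN, of "\<phi> 0"] n by simp
    then obtain \<psi> where xP: "x \<in> P \<psi>"
      by blast
    \<comment> \<open>Failure of simplicity for a nonzero semistable \<open>x\<close> means a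
      monomorphism in \<open>P \<psi>\<close> with nonzero source that is not invertible.\<close>
    then obtain f where f: "monic (full_subcat C (P \<psi>)) f" "Cod C f = x"
        "\<not> (zero_object (full_subcat C (P \<psi>)) (Dom C f) \<or> isomorphism (full_subcat C (P \<psi>)) f)"
      using ns x(2) zero_object_full_subcat unfolding simple_object_def full_subcat_simps by blast
    define y where "y = Dom C f"
    have fH: "f \<in> Hom C y x" and y: "y \<in> P \<psi>"
      using f unfolding monic_def full_subcat_simps Hom_def y_def by auto
    obtain b g h where d: "dtri y x b f g h"
      using dtri_ex[OF fH] .
    have b: "b \<in> P \<psi>"
      using cone_of_mono[OF d y xP] f(1) monic_full_subcat[OF fH y xP] by blast
    have "hn_mass q x = hn_mass q y + hn_mass q b"
      using hn_mass_semistable[OF q] y xP b Z_add[OF d] support_functional_linear(1) by simp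
    moreover have "\<not> zero_object C y"
      using f(3) y zero_object_full_subcat unfolding y_def by blast
    moreover have "\<not> zero_object C b"
      using f(3) isomorphism_full_subcat[OF fH y xP] dtri_iso_zero[OF d] by blast
    ultimately show ?thesis
      using d by blast
  qed
qed

lemma stable_iff_mass:
  assumes q: "q > 0" and x: "x \<in> Ob C"
  shows "(\<exists>\<phi>. simple_object (full_subcat C (P \<phi>)) x) \<longleftrightarrow> \<not> zero_object C x \<and>
    (\<forall>a b f g h. dtri a x b f g h \<and> \<not> zero_object C a \<and> \<not> zero_object C b \<longrightarrow>
      hn_mass q x < hn_mass q a + hn_mass q b)"
proof -
  have "\<not> zero_object C x" if "simple_object (full_subcat C (P \<phi>)) x" for \<phi>
    using that zero_object_full_subcat unfolding simple_object_def full_subcat_simps by blast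
  then show ?thesis
    using stable_mass_strict[OF q] not_stable_decomposition[OF q x] by (metis less_irrefl)
qed

end

section \<open>Application to stability conditions\<close>

lemma (in triangulated_category) central_charge_slicingI:
  assumes "stability_condition C (P, Z)"
  shows "central_charge_slicing C P (\<lambda>x. Z (K_class C x))"
proof
  show "slicing C P"
    using assms unfolding stability_condition_def by simp
  show "Z (K_class C y) = Z (K_class C x) + Z (K_class C z)" if "dtri x y z f g h" for x y z f g h
    using K_class_add[OF _ that] assms unfolding stability_condition_def by simp
  show "\<exists>r>0. Z (K_class C a) = of_real r * exp (\<i> * of_real pi * of_real \<phi>)"
    if "a \<in> P \<phi>" "\<not> zero_object C a" for a \<phi>
    using assms that unfolding stability_condition_def by simp
qed

lemma (in triangulated_category) stable_object_iff_mass: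
  assumes \<tau>: "stability_condition C \<tau>" and q: "q > 0" and x: "x \<in> Ob C"
  shows "stable_object C \<tau> x \<longleftrightarrow> \<not> zero_object C x \<and>
    (\<forall>a b f g h. dtri a x b f g h \<and> \<not> zero_object C a \<and> \<not> zero_object C b \<longrightarrow>
      mass C q \<tau> x < mass C q \<tau> a + mass C q \<tau> b)"
proof -
  obtain P Z where PZ: "\<tau> = (P, Z)"
    by (cases \<tau>)
  interpret central_charge_slicing C P "\<lambda>x. Z (K_class C x)"
    using central_charge_slicingI \<tau> unfolding PZ .
  have "mass C q \<tau> = hn_mass q"
    using hn_mass_zero unfolding fun_eq_iff mass_def PZ by (simp add: hn_mass_def)
  then show ?thesis
    using stable_iff_mass[OF q x] unfolding stable_object_def PZ by simp
qed

theorem theorem3p9: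
  fixes C :: "('o, 'm) tricat"
    and q :: real
    and \<tau> \<tau>' :: "'o stability_data"
  assumes "triangulated_category C"
    and "q > 0"
    and "locally_finite_stability_condition C \<tau>"
    and "locally_finite_stability_condition C \<tau>'"
    and "\<And>x. x \<in> Ob C \<Longrightarrow> mass C q \<tau> x = mass C q \<tau>' x"
  shows "\<forall>x \<in> Ob C. stable_object C \<tau> x \<longleftrightarrow> stable_object C \<tau>' x"
proof
  interpret triangulated_category C
    by fact
  fix x assume x: "x \<in> Ob C"
  have \<tau>: "stability_condition C \<tau>" "stability_condition C \<tau>'"
    using assms(3,4) unfolding locally_finite_stability_condition_def by auto
  \<comment> \<open>The criterion sees the stability condition only through masses of objects in
    triangles of \<open>C\<close>, where the two masses agree.\<close>
  have "mass C q \<tau> x < mass C q \<tau> a + mass C q \<tau> b \<longleftrightarrow> mass C q \<tau>' x < mass C q \<tau>' a + mass C q \<tau>' b"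
    if "dtri a x b f g h" for a b f g h
    using dtri_Hom[OF that] assms(5) by simp
  then show "stable_object C \<tau> x \<longleftrightarrow> stable_object C \<tau>' x"
    unfolding stable_object_iff_mass[OF \<tau>(1) assms(2) x] stable_object_iff_mass[OF \<tau>(2) assms(2) x]
    by blast
qed

end
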